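(* Let $k$ be a field of characteristic $0$, let $s,n\ge1$, and let $N=N(s,n)$ be the number of words $w$ in the alphabet $\{1,\dots,s\}$ with $1\le|w|\le n$. The abelian groups $(k^N,\star_{\bullet,a},0)$ induced by tensor, free and boolean independence are homogeneous of degree $\sigma_w=\deg(w)=|w|$. Each of them is isomorphic to the additive group $(k^N,+,0)$. The group isomorphisms $$(k^N,\star_{\mathrm{T},a},0)\cong(k^N,\boxplus_V,0)\cong(k^N,\star_{\mathrm{B},a},0)$$ are given by $\operatorname{EXP}_{j,a}\circ\operatorname{LOG}_{i,a}$, $i,j\in\{\mathrm T,\mathrm F,\mathrm B\}$, which are homogeneous polynomials of degree $\deg(w)$ (in the component indexed by $w$), where $\operatorname{LOG}_{i,a}:(k^N,\star_{i,a},0)\to(k^N,+,0)$ and $\operatorname{EXP}_{j,a}:(k^N,+,0)\to(k^N,\star_{j,a},0)$.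
   Context: Coordinates of $k^N$ are indexed by words $w$ with $1\le|w|\le n$; $f=(f_w)$ is regarded as a (truncated) linear functional $f(x_w)=f_w$ on non-commutative polynomials in $x_1,\dots,x_s$ without constant term, $x_w=x_{i_1}\cdots x_{i_m}$ for $w=(i_1\dots i_m)$. Homogeneous means that $\delta_\lambda:(f_w)\mapsto(\lambda^{|w|}f_w)$, $\lambda\neq0$, are automorphisms; a polynomial is homogeneous of degree $\deg(w)$ when the variable indexed by $u$ has weight $|u|$. The additive convolution is $(f\star_{\bullet,a}g)_w=(f\bullet g)\big((x_{i_1}+y_{i_1})\cdots(x_{i_m}+y_{i_m})\big)$, where $f$ acts on the $x$-variables and $g$ on the $y$-variables, and for a product $a_1\cdots a_m$ alternating between polynomials in the $x$'s ($\epsilon_i=1$) and in the $y$'s ($\epsilon_i=2$): tensor: $f\bullet_{\mathrm T}g(a_1\cdots a_m)=f(\prod_{\epsilon_i=1}a_i)g(\prod_{\epsilon_i=2}a_i)$ (value $1$ on an empty product); boolean: $f\bullet_{\mathrm B}g(a_1\cdots a_m)=\prod_{\epsilon_i=1}f(a_i)\prod_{\epsilon_i=2}g(a_i)$; free: recursively $f\bullet_{\mathrm F}g(a_1\cdots a_m)=\sum_{I\subsetneq\{1,\dots,m\}}(-1)^{m-|I|+1}f\bullet_{\mathrm F}g(\prod_{i\in I}a_i)\prod_{i\notin I}\varphi_{\epsilon_i}(a_i)$, $\varphi_1=f,\varphi_2=g$, with value $1$ on the empty product. All restrict to $f$ on $x$-polynomials and $g$ on $y$-polynomials. $\boxplus_V:=\star_{\mathrm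 F,a}$. $\operatorname{EXP}$ and $\operatorname{LOG}$ in Jacobian coordinates: for a polynomial group law $\circ$ on $k^N$ with unit $0$, let $L_x(y)=x\circ y$ and let $J_{L_x}(0)$ be the Jacobian matrix of $L_x$ at $y=0$. $\operatorname{EXP}(\xi):=\gamma(1)$, where $\gamma$ is the unique polynomial curve with $\gamma(0)=0$, $\gamma'(t)=J_{L_{\gamma(t)}}(0)\xi$; $\operatorname{LOG}:=\operatorname{EXP}^{-1}$. $\operatorname{EXP}_{i,a},\operatorname{LOG}_{i,a}$ denote these maps for $\circ=\star_{i,a}$. *)

theory Defs
  imports "HOL-Library.Poly_Mapping" "HOL-Computational_Algebra.Polynomial" "HOL-Algebra.Group"
begin

section \<open>Words and coordinate spaces\<close>

definition words :: "nat \<Rightarrow> nat \<Rightarrow> nat list set" where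
  "words s n = {w. set w \<subseteq> {1..s} \<and> 1 \<le> length w \<and> length w \<le> n}"

text \<open>The space of families of scalars indexed by \<open>W\<close>; a family is represented by the
  function that vanishes outside \<open>W\<close>.\<close>

definition coords :: "'w set \<Rightarrow> ('w \<Rightarrow> 'k::zero) set" where
  "coords W = {f. \<forall>w. w \<notin> W \<longrightarrow> f w = 0}"

definition law_monoid :: "'w set \<Rightarrow> (('w \<Rightarrow> 'k) \<Rightarrow> ('w \<Rightarrow> 'k) \<Rightarrow> 'w \<Rightarrow> 'k::zero) \<Rightarrow> ('w \<Rightarrow> 'k) monoid" where
  "law_monoid W opr = \<lparr>carrier = coords W, monoid.mult = opr, one = (\<lambda>_. 0)\<rparr>"

definition plus_law :: "('w \<Rightarrow> 'k) \<Rightarrow> ('w \<Rightarrow> 'k) \<Rightarrow> 'w \<Rightarrow> 'k::plus" where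
  "plus_law f g = (\<lambda>w. f w + g w)"

definition dilation :: "('w \<Rightarrow> nat) \<Rightarrow> 'k \<Rightarrow> ('w \<Rightarrow> 'k) \<Rightarrow> 'w \<Rightarrow> 'k::field" where
  "dilation \<sigma> c f = (\<lambda>w. c ^ \<sigma> w * f w)"

definition homogeneous_group :: "('w \<Rightarrow> nat) \<Rightarrow> ('w \<Rightarrow> 'k::field) monoid \<Rightarrow> bool" where
  "homogeneous_group \<sigma> G \<longleftrightarrow> (\<forall>c. c \<noteq> 0 \<longrightarrow> dilation \<sigma> c \<in> iso G G)"


section \<open>Polynomials in commuting variables\<close>

type_synonym ('v, 'k) mpoly = "('v \<Rightarrow>\<^sub>0 nat) \<Rightarrow>\<^sub>0 'k"

definition mpoly_eval :: "('v \<Rightarrow> 'k) \<Rightarrow> ('v, 'k::comm_semiring_1) mpoly \<Rightarrow> 'k" where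
  "mpoly_eval x P = (\<Sum>m\<in>Poly_Mapping.keys P.
     Poly_Mapping.lookup P m * (\<Prod>v\<in>Poly_Mapping.keys m. x v ^ Poly_Mapping.lookup m v))"

definition mpoly_vars :: "('v, 'k::zero) mpoly \<Rightarrow> 'v set" where
  "mpoly_vars P = (\<Union>m\<in>Poly_Mapping.keys P. Poly_Mapping.keys m)"

text \<open>Homogeneity when the variable \<open>v\<close> has weight \<open>\<sigma> v\<close>.\<close>

definition mpoly_homogeneous :: "('v \<Rightarrow> nat) \<Rightarrow> nat \<Rightarrow> ('v, 'k::zero) mpoly \<Rightarrow> bool" where
  "mpoly_homogeneous \<sigma> d P \<longleftrightarrow> (\<forall>m\<in>Poly_Mapping.keys P.
     (\<Sum>v\<in>Poly_Mapping.keys m. Poly_Mapping.lookup m v * \<sigma> v) = d)"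

definition homogeneous_polynomial_map ::
  "'w set \<Rightarrow> ('w \<Rightarrow> nat) \<Rightarrow> (('w \<Rightarrow> 'k) \<Rightarrow> 'w \<Rightarrow> 'k::comm_semiring_1) \<Rightarrow> bool" where
  "homogeneous_polynomial_map W \<sigma> h \<longleftrightarrow>
     (\<forall>w\<in>W. \<exists>P. mpoly_vars P \<subseteq> W \<and> mpoly_homogeneous \<sigma> (\<sigma> w) P
        \<and> (\<forall>x\<in>coords W. h x w = mpoly_eval x P))"

text \<open>In a polynomial law, the variables tagged \<open>Inl\<close> are the coordinates of the first argument and
  those tagged \<open>Inr\<close> the coordinates of the second.\<close>

definition polynomial_law ::
  "'w set \<Rightarrow> (('w \<Rightarrow> 'k) \<Rightarrow> ('w \<Rightarrow> 'k) \<Rightarrow> 'w \<Rightarrow> 'k::comm_semiring_1) \<Rightarrow> bool" where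
  "polynomial_law W opr \<longleftrightarrow>
     (\<forall>w\<in>W. \<exists>P. mpoly_vars P \<subseteq> Inl ` W \<union> Inr ` W
        \<and> (\<forall>x\<in>coords W. \<forall>y\<in>coords W. opr x y w = mpoly_eval (case_sum x y) P))"


section \<open>EXP and LOG of a polynomial group law\<close>

text \<open>Partial derivative at \<open>a\<close> with respect to the coordinate \<open>u\<close> of a polynomial function \<open>h\<close>:
  the formal derivative of the univariate polynomial obtained by freezing the other coordinates.
  That polynomial is unique because the field is infinite.\<close>

definition partial_deriv :: "(('w \<Rightarrow> 'k) \<Rightarrow> 'k) \<Rightarrow> 'w \<Rightarrow> ('w \<Rightarrow> 'k) \<Rightarrow> 'k::field_char_0" where
  "partial_deriv h u a = poly (pderiv (THE p. \<forall>t. poly p t = h (a(u := t)))) (a u)"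

definition jacobian :: "(('w \<Rightarrow> 'k) \<Rightarrow> 'w \<Rightarrow> 'k) \<Rightarrow> ('w \<Rightarrow> 'k) \<Rightarrow> 'w \<Rightarrow> 'w \<Rightarrow> 'k::field_char_0" where
  "jacobian L a w u = partial_deriv (\<lambda>y. L y w) u a"

definition exp_curve :: "'w set \<Rightarrow> (('w \<Rightarrow> 'k) \<Rightarrow> ('w \<Rightarrow> 'k) \<Rightarrow> 'w \<Rightarrow> 'k) \<Rightarrow> ('w \<Rightarrow> 'k)
    \<Rightarrow> ('w \<Rightarrow> 'k::field_char_0 poly) \<Rightarrow> bool" where
  "exp_curve W opr \<xi> \<gamma> \<longleftrightarrow>
     \<gamma> \<in> coords W \<and>
     (\<forall>w\<in>W. poly (\<gamma> w) 0 = 0) \<and>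
     (\<forall>t. \<forall>w\<in>W. poly (pderiv (\<gamma> w)) t
        = (\<Sum>u\<in>W. jacobian (opr (\<lambda>v. poly (\<gamma> v) t)) (\<lambda>_. 0) w u * \<xi> u))"

definition EXP :: "'w set \<Rightarrow> (('w \<Rightarrow> 'k) \<Rightarrow> ('w \<Rightarrow> 'k) \<Rightarrow> 'w \<Rightarrow> 'k) \<Rightarrow> ('w \<Rightarrow> 'k) \<Rightarrow> 'w \<Rightarrow> 'k::field_char_0" where
  "EXP W opr \<xi> = (\<lambda>w. poly ((THE \<gamma>. exp_curve W opr \<xi> \<gamma>) w) 1)"

definition LOG :: "'w set \<Rightarrow> (('w \<Rightarrow> 'k) \<Rightarrow> ('w \<Rightarrow> 'k) \<Rightarrow> 'w \<Rightarrow> 'k) \<Rightarrow> ('w \<Rightarrow> 'k) \<Rightarrow> 'w \<Rightarrow> 'k::field_char_0" where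
  "LOG W opr = inv_into (coords W) (EXP W opr)"


section \<open>Non-commutative polynomials\<close>

text \<open>The free monoid, written additively because \<open>\<Rightarrow>\<^sub>0\<close> forms the monoid algebra of an additive
  monoid; \<open>('v, 'k) ncpoly\<close> is the free associative algebra.\<close>

datatype 'v free_mon = Mon (letters: "'v list")

instantiation free_mon :: (type) monoid_add
begin

definition zero_free_mon :: "'a free_mon" where
  "zero_free_mon = Mon []"

definition plus_free_mon :: "'a free_mon \<Rightarrow> 'a free_mon \<Rightarrow> 'a free_mon" where
  "plus_free_mon u v = Mon (letters u @ letters v)"

instance
  by standard (simp_all add: zero_free_mon_def plus_free_mon_def)

end

type_synonym ('v, 'k) ncpoly = "'v free_mon \<Rightarrow>\<^sub>0 'k"

definition nc_var :: "'v \<Rightarrow> ('v, 'k::zero_neq_one) ncpoly" where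
  "nc_var v = Poly_Mapping.single (Mon [v]) 1"

text \<open>The linear functional with prescribed values on the monomials.\<close>

definition nc_functional :: "('v list \<Rightarrow> 'k) \<Rightarrow> ('v, 'k::comm_semiring_1) ncpoly \<Rightarrow> 'k" where
  "nc_functional F p = (\<Sum>m\<in>Poly_Mapping.keys p. Poly_Mapping.lookup p m * F (letters m))"


section \<open>Tensor, free and boolean products of functionals\<close>

text \<open>The variables \<open>x\<^sub>i\<close> and \<open>y\<^sub>i\<close> are the pairs \<open>(X, i)\<close> and \<open>(Y, i)\<close>. The formulas for the
  products are multilinear in the factors \<open>a\<^sub>1, \<dots>, a\<^sub>m\<close> of an alternating product, so they amount to a
  definition on monomials followed by linear extension. Every monomial is in exactly one way an
  alternating product of nonempty monomials in one kind of variable; \<open>blocks\<close> computes the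
  factors, each with the kind of its variables.\<close>

datatype side = X | Y

datatype independence = Tensor | Free | Boolean

fun blocks :: "(side \<times> 'a) list \<Rightarrow> (side \<times> 'a list) list" where
  "blocks [] = []"
| "blocks ((e, i) # u) = (case blocks u of
       [] \<Rightarrow> [(e, [i])]
     | (e', a) # bs \<Rightarrow> if e = e' then (e, i # a) # bs else (e, [i]) # (e', a) # bs)"

definition flatten :: "(side \<times> 'a list) list \<Rightarrow> (side \<times> 'a) list" where
  "flatten bs = concat (map (\<lambda>(e, a). map (Pair e) a) bs)"

lemma flatten_simps [simp]:
  "flatten [] = []"
  "flatten ((e, a) # bs) = map (Pair e) a @ flatten bs"
  by (simp_all add: flatten_def)

lemma flatten_blocks [simp]: "flatten (blocks u) = u"
proof (induction u)
  case (Cons z u)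
  obtain e i where z: "z = (e, i)" by (cases z)
  show ?case
  proof (cases "blocks u")
    case Nil
    then show ?thesis using Cons z by simp
  next
    case (Cons b bs)
    then show ?thesis using \<open>flatten (blocks u) = u\<close> z by (cases b) auto
  qed
qed simp

lemma blocks_nonempty: "(e, a) \<in> set (blocks u) \<Longrightarrow> a \<noteq> []"
  by (induction u arbitrary: e a rule: blocks.induct) (auto split: list.splits if_splits)

lemma blocks_Pair_append:
  "a \<noteq> [] \<Longrightarrow> blocks u = [] \<or> fst (hd (blocks u)) \<noteq> e \<Longrightarrow>
    blocks (map (Pair e) a @ u) = (e, a) # blocks u"
  by (induction a rule: induct_list012) (auto split: list.splits)

lemma blocks_flatten:
  assumes "successively (\<lambda>b c. fst b \<noteq> fst c) bs" and "\<forall>b\<in>set bs. snd b \<noteq> []"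
  shows "blocks (flatten bs) = bs"
  using assms
proof (induction bs)
  case (Cons b bs)
  obtain e a where b: "b = (e, a)" by (cases b)
  have IH: "blocks (flatten bs) = bs" using Cons by (auto simp: successively_Cons)
  show ?case using Cons.prems IH b
    by (simp add: blocks_Pair_append successively_Cons) (metis blocks_Pair_append IH)
qed simp

lemma successively_blocks: "successively (\<lambda>b c. fst b \<noteq> fst c) (blocks u)"
  by (induction u rule: blocks.induct)
    (auto simp: successively_Cons split: list.splits if_splits)

lemma length_flatten_nths_less:
  assumes "\<forall>(e, a)\<in>set bs. a \<noteq> []" and "I \<subset> {..<length bs}"
  shows "length (flatten (nths bs I)) < length (flatten bs)"
  using assms
proof (induction bs arbitrary: I)
  case Nil
  then show ?case by simp
next
  case (Cons b bs)
  obtain e a where b: "b = (e, a)" by (cases b)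
  define J where "J = {j. Suc j \<in> I}"
  have J: "J \<subseteq> {..<length bs}" using Cons.prems by (auto simp: J_def)
  have le: "length (flatten (nths bs J)) \<le> length (flatten bs)"
  proof (cases "J = {..<length bs}")
    case True
    then show ?thesis by (simp add: nths_all)
  next
    case False
    then have "J \<subset> {..<length bs}" using J by blast
    then show ?thesis using Cons.IH[of J] Cons.prems by auto
  qed
  show ?case
  proof (cases "0 \<in> I")
    case True
    have "J \<noteq> {..<length bs}"
    proof
      assume "J = {..<length bs}"
      then have "x \<in> I" if "x < Suc (length bs)" for x
        using that True by (cases x) (auto simp: J_def)
      then show False using Cons.prems(2) by auto
    qed
    then have "J \<subset> {..<length bs}" using J by blast
    then show ?thesis using Cons.IH[of J] Cons.prems True b by (auto simp: nths_Cons J_def)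
  next
    case False
    have "0 < length a" using Cons.prems(1) b by auto
    moreover have "length (flatten (nths (b # bs) I)) = length (flatten (nths bs J))"
      using False by (simp add: nths_Cons J_def)
    moreover have "length (flatten (b # bs)) = length a + length (flatten bs)"
      using b by simp
    ultimately show ?thesis using le by linarith
  qed
qed

definition tensor_product :: "('a list \<Rightarrow> 'k) \<Rightarrow> ('a list \<Rightarrow> 'k) \<Rightarrow> (side \<times> 'a) list \<Rightarrow> 'k::comm_ring_1" where
  "tensor_product f g u =
     (let bs = blocks u;
          unital = (\<lambda>\<phi> w. if w = [] then 1 else \<phi> w);
          part = (\<lambda>e. concat (map snd (filter (\<lambda>b. fst b = e) bs)))
      in unital f (part X) * unital g (part Y))"

definition boolean_product :: "('a list \<Rightarrow> 'k) \<Rightarrow> ('a list \<Rightarrow> 'k) \<Rightarrow> (side \<times> 'a) list \<Rightarrow> 'k::comm_ring_1" where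
  "boolean_product f g u =
     (let bs = blocks u
      in prod_list (map (\<lambda>b. f (snd b)) (filter (\<lambda>b. fst b = X) bs))
       * prod_list (map (\<lambda>b. g (snd b)) (filter (\<lambda>b. fst b = Y) bs)))"

text \<open>\<open>nths (blocks u) I\<close> need not alternate; the recursive call regroups it.\<close>

function free_product :: "('a list \<Rightarrow> 'k) \<Rightarrow> ('a list \<Rightarrow> 'k) \<Rightarrow> (side \<times> 'a) list \<Rightarrow> 'k::comm_ring_1" where
  "free_product f g u =
     (if u = [] then 1
      else \<Sum>I\<in>{I. I \<subset> {..<length (blocks u)}}.
        (- 1) ^ (length (blocks u) - card I + 1)
        * free_product f g (flatten (nths (blocks u) I))
        * (\<Prod>i\<in>{..<length (blocks u)} - I.
             (case fst (blocks u ! i) of X \<Rightarrow> f | Y \<Rightarrow> g) (snd (blocks u ! i))))"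
  by auto
termination
proof (relation "measure (\<lambda>(f, g, u). length u)", goal_cases)
  case 1
  show ?case by simp
next
  case (2 f g u I)
  have "length (flatten (nths (blocks u) I)) < length (flatten (blocks u))"
    using 2 by (intro length_flatten_nths_less) (auto dest: blocks_nonempty)
  then show ?case by simp
qed

declare free_product.simps [simp del]

text \<open>The defining formulas for an arbitrary alternating product of monomials.\<close>

lemma free_product_alternating:
  assumes "successively (\<lambda>b c. fst b \<noteq> fst c) bs" and "\<forall>b\<in>set bs. snd b \<noteq> []" and "bs \<noteq> []"
  shows "free_product f g (flatten bs) = (\<Sum>I\<in>{I. I \<subset> {..<length bs}}.
    (- 1) ^ (length bs - card I + 1) * free_product f g (flatten (nths bs I))
    * (\<Prod>i\<in>{..<length bs} - I. (case fst (bs ! i) of X \<Rightarrow> f | Y \<Rightarrow> g) (snd (bs ! i))))"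
proof -
  have bl: "blocks (flatten bs) = bs" by (rule blocks_flatten) fact+
  then have "flatten bs \<noteq> []" using assms(3) by force
  then show ?thesis by (subst free_product.simps) (simp only: bl if_False)
qed

lemma tensor_product_alternating:
  assumes "successively (\<lambda>b c. fst b \<noteq> fst c) bs" and "\<forall>b\<in>set bs. snd b \<noteq> []"
  shows "tensor_product f g (flatten bs) =
    (let unital = (\<lambda>\<phi> w. if w = [] then 1 else \<phi> w);
         part = (\<lambda>e. concat (map snd (filter (\<lambda>b. fst b = e) bs)))
     in unital f (part X) * unital g (part Y))"
  by (simp only: tensor_product_def Let_def blocks_flatten[OF assms])

lemma boolean_product_alternating:
  assumes "successively (\<lambda>b c. fst b \<noteq> fst c) bs" and "\<forall>b\<in>set bs. snd b \<noteq> []"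
  shows "boolean_product f g (flatten bs) =
    prod_list (map (\<lambda>b. f (snd b)) (filter (\<lambda>b. fst b = X) bs))
    * prod_list (map (\<lambda>b. g (snd b)) (filter (\<lambda>b. fst b = Y) bs))"
  by (simp only: boolean_product_def Let_def blocks_flatten[OF assms])

fun indep_product :: "independence \<Rightarrow> ('a list \<Rightarrow> 'k) \<Rightarrow> ('a list \<Rightarrow> 'k) \<Rightarrow> (side \<times> 'a) list \<Rightarrow> 'k::comm_ring_1" where
  "indep_product Tensor = tensor_product"
| "indep_product Free = free_product"
| "indep_product Boolean = boolean_product"


section \<open>Additive convolution\<close>

text \<open>For a word of length at most \<open>n\<close> only the values of \<open>f\<close> and \<open>g\<close> on words in \<open>words s n\<close>
  enter.\<close>

definition add_conv :: "independence \<Rightarrow> nat \<Rightarrow> nat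
    \<Rightarrow> (nat list \<Rightarrow> 'k) \<Rightarrow> (nat list \<Rightarrow> 'k) \<Rightarrow> nat list \<Rightarrow> 'k::comm_ring_1" where
  "add_conv i s n f g w =
     (if w \<in> words s n
      then nc_functional (indep_product i f g)
             (prod_list (map (\<lambda>j. nc_var (X, j) + nc_var (Y, j)) w))
      else 0)"

definition conv_group :: "independence \<Rightarrow> nat \<Rightarrow> nat \<Rightarrow> (nat list \<Rightarrow> 'k::comm_ring_1) monoid" where
  "conv_group i s n = law_monoid (words s n) (add_conv i s n)"

definition additive_group :: "nat \<Rightarrow> nat \<Rightarrow> (nat list \<Rightarrow> 'k::comm_ring_1) monoid" where
  "additive_group s n = law_monoid (words s n) plus_law"

end

(*
  Each of the three independences has cumulants. The moment of a word is the sum, over all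
  (tensor), noncrossing (free) or interval (boolean) partitions of its letters, of the products of the
  cumulants of the blocks. The key fact is that the product of two functionals has as its cumulants
  the mixed ones: those of the first functional on words in x, those of the second on words in y, and 0
  on all other words. Summing over the labellings of a word, cumulants of the additive convolution
  add, so the moment map is an isomorphism from the additive group. It is homogeneous, triangular and
  has identity linear part; in cumulant coordinates the equation of the exponential moment_curve becomes
  delta' = xi, whence EXP is the moment map and LOG the cumulant map.
*)
theory Submission
  imports Defs "HOL-Library.Disjoint_Sets"
begin

section \<open>Partitions and moments\<close>

text \<open>The free product is the obstacle: its recursion deletes runs, and the letters that
  remain merge into a word with other runs. All sums are therefore taken over partitions of sets of
  positions in one fixed word. Admissibility sees only the order of the positions, so deleting runs
  just means passing to a subset. Brought to one side, the recursion is an inclusion-exclusion over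
  the sets \<open>J\<close> of runs that are evaluated separately, and the term of \<open>J\<close>
  is the sum over the partitions in which each run of \<open>J\<close> is a union of blocks. What
  has to be excluded is a noncrossing partition with one-sided blocks in which no run is such a
  union.

  \<open>mom\<close> and \<open>cum\<close> are defined over any commutative ring. Used in
  \<open>'k poly\<close>, they turn a polynomial curve of functionals into a polynomial curve of
  cumulants, and evaluation commutes with both; the formal derivatives behind EXP are computed in
  this way, without calculus in several variables. Truncation does no harm, since moments and
  cumulants of a word consult only words that are no longer and have no new letters.\<close>

fun admissible :: "independence \<Rightarrow> nat set set \<Rightarrow> bool" where
  "admissible Tensor \<pi> \<longleftrightarrow> True"
| "admissible Free \<pi> \<longleftrightarrow> (\<forall>B\<in>\<pi>. \<forall>C\<in>\<pi>. \<forall>a\<in>B. \<forall>b\<in>C. \<forall>c\<in>B. \<forall>d\<in>C. a < b \<and> b < c \<and> c < d \<longrightarrow> B = C)"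
| "admissible Boolean \<pi> \<longleftrightarrow> (\<forall>B\<in>\<pi>. \<forall>C\<in>\<pi>. \<forall>a\<in>B. \<forall>b\<in>C. \<forall>c\<in>B. a < b \<and> b < c \<longrightarrow> B = C)"

text \<open>\<open>A\<close> may be any set of positions. Since \<open>admissible\<close> compares
  only elements of blocks, noncrossing and interval are meant relative to \<open>A\<close>, and gaps
  left by deleted positions do not matter.\<close>

definition parts :: "independence \<Rightarrow> nat set \<Rightarrow> nat set set set" where
  "parts i A = {\<pi>. partition_on A \<pi> \<and> admissible i \<pi>}"

definition mom :: "independence \<Rightarrow> ('a list \<Rightarrow> 'k) \<Rightarrow> 'a list \<Rightarrow> 'k::comm_ring_1" where
  "mom i \<kappa> w = (\<Sum>\<pi>\<in>parts i {..<length w}. \<Prod>B\<in>\<pi>. \<kappa> (nths w B))"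

lemma admissible_mono: "admissible i \<pi> \<Longrightarrow> \<pi>' \<subseteq> \<pi> \<Longrightarrow> admissible i \<pi>'"
  by (cases i) (simp_all, blast+)

lemma admissible_image:
  assumes "admissible i \<pi>" and "strict_mono_on (\<Union>\<pi>) r"
  shows "admissible i ((`) r ` \<pi>)"
proof -
  have less: "x < y" if "r x < r y" "x \<in> \<Union>\<pi>" "y \<in> \<Union>\<pi>" for x y
    using strict_mono_on_less[OF assms(2)] that by blast
  show ?thesis
  proof (cases i)
    case Free
    have "r ` B = r ` C" if "B \<in> \<pi>" "C \<in> \<pi>" "a \<in> B" "b \<in> C" "c \<in> B" "d \<in> C"
      "r a < r b" "r b < r c" "r c < r d" for B C a b c d
    proof -
      have "a < b" "b < c" "c < d" using that by (auto intro: less)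
      then have "B = C" using Free assms(1) that by (simp, blast)
      then show ?thesis by simp
    qed
    then show ?thesis using Free by (simp, blast)
  next
    case Boolean
    have "r ` B = r ` C" if "B \<in> \<pi>" "C \<in> \<pi>" "a \<in> B" "b \<in> C" "c \<in> B"
      "r a < r b" "r b < r c" for B C a b c
    proof -
      have "a < b" "b < c" using that by (auto intro: less)
      then have "B = C" using Boolean assms(1) that by (simp, blast)
      then show ?thesis by simp
    qed
    then show ?thesis using Boolean by (simp, blast)
  qed simp
qed

lemma parts_empty [simp]: "parts i {} = {{}}"
  by (cases i) (auto simp: parts_def partition_on_empty)

lemma finite_parts: "finite A \<Longrightarrow> finite (parts i A)"
  by (rule finite_subset[OF _ finitely_many_partition_on[of A]]) (auto simp: parts_def)

lemma
  assumes "\<pi> \<in> parts i A"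
  shows parts_Union: "\<Union>\<pi> = A"
    and parts_block: "B \<in> \<pi> \<Longrightarrow> B \<subseteq> A"
    and parts_block_nonempty: "B \<in> \<pi> \<Longrightarrow> B \<noteq> {}"
    and parts_disjoint: "B \<in> \<pi> \<Longrightarrow> C \<in> \<pi> \<Longrightarrow> B \<noteq> C \<Longrightarrow> B \<inter> C = {}"
    and parts_finite: "finite A \<Longrightarrow> finite \<pi>"
  using assms finite_elements[of A \<pi>]
  by (auto simp: parts_def partition_on_def disjoint_def)

lemma top_in_parts: "A \<noteq> {} \<Longrightarrow> {A} \<in> parts i A"
  by (cases i) (auto simp: parts_def partition_on_space)

lemma parts_image:
  assumes "\<pi> \<in> parts i A" and "strict_mono_on A r"
  shows "(`) r ` \<pi> \<in> parts i (r ` A)"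
proof -
  have "partition_on (r ` A) ((`) r ` \<pi> - {{}})"
    using assms by (intro partition_on_inj_image strict_mono_on_imp_inj_on) (auto simp: parts_def)
  moreover have "{} \<notin> (`) r ` \<pi>" using parts_block_nonempty[OF assms(1)] by auto
  ultimately show ?thesis
    using admissible_image[of i \<pi> r] assms parts_Union[OF assms(1)] by (simp add: parts_def)
qed

lemma sum_parts_reindex:
  assumes "strict_mono_on A r"
  shows "(\<Sum>\<pi>\<in>parts i (r ` A). F \<pi>) = (\<Sum>\<pi>\<in>parts i A. F ((`) r ` \<pi>))"
proof -
  define q where "q = the_inv_into A r"
  have inj: "inj_on r A" using assms by (rule strict_mono_on_imp_inj_on)
  have qr [simp]: "q (r x) = x" if "x \<in> A" for x
    using inj that by (simp add: q_def the_inv_into_f_f)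
  have q: "strict_mono_on (r ` A) q"
    using strict_mono_on_less[OF assms] by (auto simp: strict_mono_on_def)
  have qA: "q ` r ` A = A" by (force simp: image_image)
  have 1: "q ` r ` B = B" if "B \<subseteq> A" for B
    using that by (force simp: image_image)
  have 2: "r ` q ` B = B" if "B \<subseteq> r ` A" for B
    using that by (force simp: image_image)
  have 3: "(`) q ` (`) r ` \<pi> = \<pi>" if "\<pi> \<in> parts i A" for \<pi>
    using 1 parts_block[OF that] by (force simp: image_image)
  have 4: "(`) r ` (`) q ` \<pi> = \<pi>" if "\<pi> \<in> parts i (r ` A)" for \<pi>
    using 2 parts_block[OF that] by (force simp: image_image)
  show ?thesis
    by (rule sum.reindex_bij_witness[where i = "(`) ((`) r)" and j = "(`) ((`) q)"])
      (use 3 4 qA parts_image[OF _ assms] parts_image[OF _ q] in auto)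
qed

text \<open>The rank \<open>r\<close> of a position within \<open>A\<close> is the place of its
  letter in \<open>nths u A\<close>, and \<open>r\<close> preserves order. Moments of subwords can
  therefore be computed with positions of \<open>u\<close> itself.\<close>

lemma mom_nths:
  assumes "A \<subseteq> {..<length u}"
  shows "mom i \<kappa> (nths u A) = (\<Sum>\<pi>\<in>parts i A. \<Prod>B\<in>\<pi>. \<kappa> (nths u B))"
proof -
  define r where "r x = card {y \<in> A. y < x}" for x
  have fin: "finite A" using assms finite_subset by blast
  have r: "strict_mono_on A r"
    unfolding strict_mono_on_def r_def using fin by (auto intro!: psubset_card_mono)
  have inj: "inj_on r A" using r by (rule strict_mono_on_imp_inj_on)
  have "r ` A \<subseteq> {..<card A}"
    using fin by (auto simp: r_def intro!: psubset_card_mono)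
  then have rA: "r ` A = {..<card A}"
    using card_image[OF inj] by (intro card_subset_eq) auto
  have "length (nths u A) = card A"
    using assms by (auto simp: length_nths intro!: arg_cong[where f = card])
  then have "mom i \<kappa> (nths u A) = (\<Sum>\<pi>\<in>parts i (r ` A). \<Prod>B\<in>\<pi>. \<kappa> (nths (nths u A) B))"
    by (simp add: mom_def rA)
  also have "\<dots> = (\<Sum>\<pi>\<in>parts i A. \<Prod>B\<in>(`) r ` \<pi>. \<kappa> (nths (nths u A) B))"
    by (rule sum_parts_reindex[OF r])
  also have "\<dots> = (\<Sum>\<pi>\<in>parts i A. \<Prod>B\<in>\<pi>. \<kappa> (nths u B))"
  proof (rule sum.cong[OF refl])
    fix \<pi> assume pi: "\<pi> \<in> parts i A"
    have "inj_on ((`) r) \<pi>"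
      using inj_on_image_eq_iff[OF inj] parts_block[OF pi] by (auto simp: inj_on_def)
    moreover have "nths (nths u A) (r ` B) = nths u B" if "B \<in> \<pi>" for B
    proof -
      have "B \<subseteq> A" using parts_block[OF pi that] .
      then have "{x \<in> A. \<exists>j\<in>r ` B. r x = j} = B"
        using inj by (auto simp: inj_on_def)
      then show ?thesis by (simp add: nths_nths r_def)
    qed
    ultimately show "(\<Prod>B\<in>(`) r ` \<pi>. \<kappa> (nths (nths u A) B)) = (\<Prod>B\<in>\<pi>. \<kappa> (nths u B))"
      by (simp add: prod.reindex)
  qed
  finally show ?thesis .
qed

lemma mom_Nil [simp]: "mom i \<kappa> [] = 1"
  by (simp add: mom_def)

lemma nths_block:
  assumes "\<pi> \<in> parts i {..<length w}" and "B \<in> \<pi>"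
  shows "nths w B \<noteq> []" and "length (nths w B) = card B"
proof -
  have "B \<subseteq> {..<length w}" using parts_block[OF assms] .
  then have "{j. j < length w \<and> j \<in> B} = B" by auto
  then show len: "length (nths w B) = card B" by (simp add: length_nths)
  moreover have "card B > 0"
    using parts_block_nonempty[OF assms] \<open>B \<subseteq> _\<close> finite_subset by (fastforce simp: card_gt_0_iff)
  ultimately show "nths w B \<noteq> []" by force
qed

text \<open>A block that fills all positions leaves room for no other, so it occurs only in the
  one-block partition. \<open>cum\<close> terminates for this reason, and inductions on word length
  rely on it.\<close>

lemma length_nths_proper_block:
  assumes "\<pi> \<in> parts i {..<length w} - {{{..<length w}}}" and "B \<in> \<pi>"
  shows "length (nths w B) < length w"
proof -
  have pi: "\<pi> \<in> parts i {..<length w}" using assms by blast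
  have "B \<noteq> {..<length w}"
  proof
    assume B: "B = {..<length w}"
    have "C = B" if "C \<in> \<pi>" for C
      using parts_disjoint[OF pi that assms(2)] parts_block[OF pi that]
        parts_block_nonempty[OF pi that] B by blast
    then show False using assms B by blast
  qed
  then have "B \<subset> {..<length w}" using parts_block[OF pi assms(2)] by blast
  then have "card B < card {..<length w}" by (intro psubset_card_mono) auto
  then show ?thesis using nths_block(2)[OF pi assms(2)] by simp
qed

text \<open>The one-block partition is admissible for all three independences; the terms left over
  involve only cumulants of shorter words.\<close>

lemma mom_top:
  assumes "w \<noteq> []"
  shows "mom i \<kappa> w = \<kappa> w
    + (\<Sum>\<pi>\<in>parts i {..<length w} - {{{..<length w}}}. \<Prod>B\<in>\<pi>. \<kappa> (nths w B))"
proof -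
  have "{{..<length w}} \<in> parts i {..<length w}" using assms by (intro top_in_parts) auto
  moreover have "nths w {..<length w} = w" by (simp add: nths_all)
  ultimately show ?thesis
    by (simp add: mom_def sum.remove[of _ "{{..<length w}}"] finite_parts)
qed

lemma mom_cong:
  assumes "\<And>A. nths w A \<noteq> [] \<Longrightarrow> \<kappa> (nths w A) = \<kappa>' (nths w A)"
  shows "mom i \<kappa> w = mom i \<kappa>' w"
  unfolding mom_def
  by (intro sum.cong prod.cong refl assms) (auto dest: nths_block)


section \<open>Cumulants\<close>

text \<open>The value on the empty word is junk; blocks of a partition are never empty.\<close>

function cum :: "independence \<Rightarrow> ('a list \<Rightarrow> 'k) \<Rightarrow> 'a list \<Rightarrow> 'k::comm_ring_1" where
  "cum i f w = f w
    - (\<Sum>\<pi>\<in>parts i {..<length w} - {{{..<length w}}}. \<Prod>B\<in>\<pi>. cum i f (nths w B))"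
  by auto
termination
  by (relation "measure (\<lambda>(i, f, w). length w)") (simp_all add: length_nths_proper_block)

declare cum.simps [simp del]

lemma mom_cum: "w \<noteq> [] \<Longrightarrow> mom i (cum i f) w = f w"
  by (subst mom_top) (simp_all add: cum.simps[of i f w])

lemma proper_block_nths_eqI:
  assumes "\<And>v. v \<noteq> [] \<Longrightarrow> length v < length w \<Longrightarrow> set v \<subseteq> set w \<Longrightarrow> \<kappa> v = \<kappa>' v"
  shows "(\<Sum>\<pi>\<in>parts i {..<length w} - {{{..<length w}}}. \<Prod>B\<in>\<pi>. \<kappa> (nths w B))
    = (\<Sum>\<pi>\<in>parts i {..<length w} - {{{..<length w}}}. \<Prod>B\<in>\<pi>. \<kappa>' (nths w B))"
  by (intro sum.cong prod.cong refl assms)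
    (use nths_block(1) in \<open>auto simp: length_nths_proper_block set_nths_subset\<close>)

text \<open>The hypothesis is confined to words that the recursion for \<open>w\<close> can reach,
  so that it applies to a truncated family, which is a moment function only on short words in the
  given letters.\<close>

lemma cum_mom:
  assumes "\<And>v. v \<noteq> [] \<Longrightarrow> length v \<le> length w \<Longrightarrow> set v \<subseteq> set w \<Longrightarrow> f v = mom i \<kappa> v"
    and "w \<noteq> []"
  shows "cum i f w = \<kappa> w"
  using assms
proof (induction "length w" arbitrary: w rule: less_induct)
  case less
  have eq: "cum i f v = \<kappa> v" if "v \<noteq> []" "length v < length w" "set v \<subseteq> set w" for v
    using that less.prems(1) by (intro less.hyps) (auto dest: order.trans)
  have "cum i f w = mom i \<kappa> w
      - (\<Sum>\<pi>\<in>parts i {..<length w} - {{{..<length w}}}. \<Prod>B\<in>\<pi>. cum i f (nths w B))"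
    using less.prems by (subst cum.simps) simp
  also have "\<dots> = \<kappa> w"
    using less.prems(2) by (simp add: mom_top proper_block_nths_eqI[of w "cum i f" \<kappa>] eq)
  finally show ?case .
qed

section \<open>Factorisation along saturated sets of positions\<close>

definition saturated :: "nat set \<Rightarrow> nat set set \<Rightarrow> bool" where
  "saturated A \<pi> \<longleftrightarrow> (\<forall>B\<in>\<pi>. B \<subseteq> A \<or> B \<inter> A = {})"

text \<open>Moments with the weight of a block given as a function of its positions. With
  \<open>h B = \<kappa> (nths u B)\<close> the moments of all subwords of \<open>u\<close> share one
  \<open>h\<close> and can be compared.\<close>

definition set_mom :: "independence \<Rightarrow> (nat set \<Rightarrow> 'k) \<Rightarrow> nat set \<Rightarrow> 'k::comm_ring_1" where
  "set_mom i h A = (\<Sum>\<pi>\<in>parts i A. \<Prod>B\<in>\<pi>. h B)"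

lemma mom_nths_set_mom:
  "A \<subseteq> {..<length u} \<Longrightarrow> mom i \<kappa> (nths u A) = set_mom i (\<lambda>B. \<kappa> (nths u B)) A"
  by (simp add: mom_nths set_mom_def)

lemma mom_set_mom: "mom i \<kappa> u = set_mom i (\<lambda>B. \<kappa> (nths u B)) {..<length u}"
  by (simp add: mom_def set_mom_def)

text \<open>A saturated set splits off from an admissible partition; the converse depends on the position of
  the set: it has to be convex in the noncrossing and initial in the interval case.\<close>

definition splits :: "independence \<Rightarrow> nat set \<Rightarrow> nat set \<Rightarrow> bool" where
  "splits i A V \<longleftrightarrow> A \<subseteq> V
    \<and> (i = Free \<longrightarrow> (\<forall>a\<in>A. \<forall>c\<in>A. \<forall>b\<in>V. a < b \<and> b < c \<longrightarrow> b \<in> A))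
    \<and> (i = Boolean \<longrightarrow> (\<forall>a\<in>A. \<forall>b\<in>V - A. a < b))"

lemma parts_join:
  assumes "splits i A V" and p: "\<pi> \<in> parts i A" and q: "\<rho> \<in> parts i (V - A)"
  shows "\<pi> \<union> \<rho> \<in> parts i V"
proof -
  have AV: "A \<subseteq> V" using assms(1) by (simp add: splits_def)
  have blocks: "B \<subseteq> A" if "B \<in> \<pi>" for B using parts_block[OF p that] .
  have blocks': "B \<subseteq> V - A" if "B \<in> \<rho>" for B using parts_block[OF q that] .
  have adm: "admissible i \<pi>" "admissible i \<rho>" using p q by (auto simp: parts_def)
  have "partition_on V (\<pi> \<union> \<rho>)"
  proof (rule partition_onI)
    show "\<Union>(\<pi> \<union> \<rho>) = V" using parts_Union[OF p] parts_Union[OF q] AV by auto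
    show "{} \<notin> \<pi> \<union> \<rho>" using parts_block_nonempty[OF p] parts_block_nonempty[OF q] by blast
    show "disjnt B C" if "B \<in> \<pi> \<union> \<rho>" "C \<in> \<pi> \<union> \<rho>" "B \<noteq> C" for B C
      using that blocks blocks' parts_disjoint[OF p] parts_disjoint[OF q]
      by (auto simp: disjnt_def) blast+
  qed
  moreover have "admissible i (\<pi> \<union> \<rho>)"
  proof (cases i)
    case Free
    then have conv: "b \<in> A" if "a \<in> A" "c \<in> A" "b \<in> V" "a < b" "b < c" for a b c
      using assms(1) that unfolding splits_def by blast
    have "B = C" if BC: "B \<in> \<pi> \<union> \<rho>" "C \<in> \<pi> \<union> \<rho>" and m: "a \<in> B" "b \<in> C" "c \<in> B" "d \<in> C"
      and l: "a < b" "b < c" "c < d" for B C a b c d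
    proof -
      consider "B \<in> \<pi>" "C \<in> \<pi>" | "B \<in> \<rho>" "C \<in> \<rho>" | "B \<in> \<pi>" "C \<in> \<rho>" | "B \<in> \<rho>" "C \<in> \<pi>"
        using BC by blast
      then show ?thesis
      proof cases
        case 1
        then show ?thesis using adm(1) Free m l by (simp, blast)
      next
        case 2
        then show ?thesis using adm(2) Free m l by (simp, blast)
      next
        case 3
        \<comment> \<open>A block inside \<open>A\<close> has elements on both sides of
          \<open>b\<close>; convexity would put \<open>b\<close> into \<open>A\<close>, which
          \<open>C\<close> avoids. The remaining case is the mirror image, with \<open>c\<close>
          between \<open>b\<close> and \<open>d\<close>.\<close>
        then show ?thesis using conv[of a c b] blocks[of B] blocks'[of C] m l by blast
      next
        case 4
        then show ?thesis using conv[of b d c] blocks[of C] blocks'[of B] m l by blast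
      qed
    qed
    then show ?thesis unfolding Free admissible.simps by blast
  next
    case Boolean
    then have init: "a < b" if "a \<in> A" "b \<in> V - A" for a b
      using assms(1) that unfolding splits_def by blast
    have "B = C" if BC: "B \<in> \<pi> \<union> \<rho>" "C \<in> \<pi> \<union> \<rho>" and m: "a \<in> B" "b \<in> C" "c \<in> B"
      and l: "a < b" "b < c" for B C a b c
    proof -
      consider "B \<in> \<pi>" "C \<in> \<pi>" | "B \<in> \<rho>" "C \<in> \<rho>" | "B \<in> \<pi>" "C \<in> \<rho>" | "B \<in> \<rho>" "C \<in> \<pi>"
        using BC by blast
      then show ?thesis
      proof cases
        case 1
        then show ?thesis using adm(1) Boolean m l by (simp, blast)
      next
        case 2
        then show ?thesis using adm(2) Boolean m l by (simp, blast)
      next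
        case 3
        then have "c < b" using init[of c b] blocks[of B] blocks'[of C] m by blast
        then show ?thesis using l by simp
      next
        case 4
        then have "b < a" using init[of b a] blocks[of C] blocks'[of B] m by blast
        then show ?thesis using l by simp
      qed
    qed
    then show ?thesis unfolding Boolean admissible.simps by blast
  qed simp
  ultimately show ?thesis by (simp add: parts_def)
qed

lemma parts_restrict:
  assumes "\<pi> \<in> parts i V" and "\<Union>\<pi>' = A" and "\<pi>' \<subseteq> \<pi>"
  shows "\<pi>' \<in> parts i A"
  using assms admissible_mono[of i \<pi> \<pi>']
  by (auto simp: parts_def partition_on_def intro: pairwise_subset)

text \<open>A saturated partition corresponds to the pair of its blocks inside and outside
  \<open>A\<close>. Restricting always preserves admissibility; rejoining is where
  \<open>splits\<close> enters. The summand \<open>F\<close> is arbitrary so that it can carry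
  saturation conditions for further sets.\<close>

lemma sum_parts_split:
  assumes "splits i A V"
  shows "(\<Sum>\<pi>\<in>{\<pi> \<in> parts i V. saturated A \<pi>}. F \<pi>)
    = (\<Sum>\<pi>\<in>parts i A. \<Sum>\<rho>\<in>parts i (V - A). F (\<pi> \<union> \<rho>))"
proof -
  have AV: "A \<subseteq> V" using assms by (simp add: splits_def)
  define l where "l \<pi> = {B \<in> \<pi>. B \<subseteq> A}" for \<pi>
  define r where "r \<pi> = {B \<in> \<pi>. B \<inter> A = {}}" for \<pi>
  have "(\<Sum>\<pi>\<in>{\<pi> \<in> parts i V. saturated A \<pi>}. F \<pi>)
      = (\<Sum>p\<in>parts i A \<times> parts i (V - A). F (fst p \<union> snd p))"
  proof (rule sum.reindex_bij_witness[where i = "\<lambda>p. fst p \<union> snd p" and j = "\<lambda>\<pi>. (l \<pi>, r \<pi>)"])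
    fix \<pi> assume "\<pi> \<in> {\<pi> \<in> parts i V. saturated A \<pi>}"
    then have pi: "\<pi> \<in> parts i V" and "saturated A \<pi>" by auto
    then have sat: "B \<subseteq> A \<or> B \<inter> A = {}" if "B \<in> \<pi>" for B
      using that by (auto simp: saturated_def)
    have eq: "l \<pi> \<union> r \<pi> = \<pi>"
      using sat by (auto simp: l_def r_def)
    then show "fst (l \<pi>, r \<pi>) \<union> snd (l \<pi>, r \<pi>) = \<pi>"
      and "F (fst (l \<pi>, r \<pi>) \<union> snd (l \<pi>, r \<pi>)) = F \<pi>" by simp_all
    have "\<Union>(l \<pi>) = A"
    proof
      show "A \<subseteq> \<Union>(l \<pi>)"
      proof
        fix x assume "x \<in> A"
        then obtain B where "B \<in> \<pi>" "x \<in> B" using parts_Union[OF pi] AV by blast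
        then show "x \<in> \<Union>(l \<pi>)" using sat[of B] \<open>x \<in> A\<close> by (auto simp: l_def)
      qed
    qed (auto simp: l_def)
    moreover have "\<Union>(r \<pi>) = V - A"
    proof
      show "V - A \<subseteq> \<Union>(r \<pi>)"
      proof
        fix x assume x: "x \<in> V - A"
        then obtain B where "B \<in> \<pi>" "x \<in> B" using parts_Union[OF pi] by blast
        then show "x \<in> \<Union>(r \<pi>)" using sat[of B] x by (auto simp: r_def)
      qed
      show "\<Union>(r \<pi>) \<subseteq> V - A" using parts_block[OF pi] by (auto simp: r_def)
    qed
    ultimately show "(l \<pi>, r \<pi>) \<in> parts i A \<times> parts i (V - A)"
      using parts_restrict[OF pi, of "l \<pi>"] parts_restrict[OF pi, of "r \<pi>"]
      by (simp add: l_def r_def)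
  next
    fix p assume "p \<in> parts i A \<times> parts i (V - A)"
    then obtain \<pi> \<rho> where p: "p = (\<pi>, \<rho>)" "\<pi> \<in> parts i A" "\<rho> \<in> parts i (V - A)" by auto
    have 1: "B \<subseteq> A" "B \<noteq> {}" if "B \<in> \<pi>" for B
      using parts_block[OF p(2) that] parts_block_nonempty[OF p(2) that] by auto
    have 2: "B \<subseteq> V - A" "B \<noteq> {}" if "B \<in> \<rho>" for B
      using parts_block[OF p(3) that] parts_block_nonempty[OF p(3) that] by auto
    have "\<not> B \<subseteq> A" if "B \<in> \<rho>" for B using 2[OF that] by blast
    moreover have "B \<inter> A \<noteq> {}" if "B \<in> \<pi>" for B using 1[OF that] by blast
    moreover have "B \<inter> A = {}" if "B \<in> \<rho>" for B using 2[OF that] by blast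
    ultimately show "(l (fst p \<union> snd p), r (fst p \<union> snd p)) = p"
      using 1(1) by (simp add: p(1) l_def r_def) blast
    have "saturated A (\<pi> \<union> \<rho>)" using 1 2 unfolding saturated_def by blast
    then show "fst p \<union> snd p \<in> {\<pi> \<in> parts i V. saturated A \<pi>}"
      using parts_join[OF assms p(2,3)] p by simp
  qed
  then show ?thesis by (simp add: sum.cartesian_product case_prod_unfold)
qed

lemma prod_parts_join:
  assumes "finite V" and "\<pi> \<in> parts i A" and "\<rho> \<in> parts i (V - A)" and "A \<subseteq> V"
  shows "prod h (\<pi> \<union> \<rho>) = prod h \<pi> * prod h \<rho>"
proof -
  have "\<pi> \<inter> \<rho> = {}"
    using parts_block[OF assms(2)] parts_block[OF assms(3)] parts_block_nonempty[OF assms(2)]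
    by blast
  then show ?thesis
    using assms parts_finite[OF assms(2)] parts_finite[OF assms(3)] finite_subset[of A V]
    by (simp add: prod.union_disjoint)
qed

text \<open>Serves the tensor and boolean products, where a suitable \<open>A\<close> is saturated
  by every partition of nonzero weight. In the free case no prescribed run has this
  property.\<close>

lemma set_mom_split:
  assumes "finite V" and "splits i A V"
    and zero: "\<And>\<pi>. \<pi> \<in> parts i V \<Longrightarrow> \<not> saturated A \<pi> \<Longrightarrow> prod h \<pi> = 0"
  shows "set_mom i h V = set_mom i h A * set_mom i h (V - A)"
proof -
  have AV: "A \<subseteq> V" using assms(2) by (simp add: splits_def)
  have "set_mom i h V = (\<Sum>\<pi>\<in>{\<pi> \<in> parts i V. saturated A \<pi>}. prod h \<pi>)"
    unfolding set_mom_def using zero assms(1)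
    by (intro sum.mono_neutral_right) (auto simp: finite_parts)
  also have "\<dots> = (\<Sum>\<pi>\<in>parts i A. \<Sum>\<rho>\<in>parts i (V - A). prod h \<pi> * prod h \<rho>)"
    by (simp add: sum_parts_split[OF assms(2)] prod_parts_join[OF assms(1) _ _ AV])
  finally show ?thesis by (simp add: set_mom_def sum_product)
qed


section \<open>Mixed cumulants\<close>

text \<open>On the empty word both conditions hold and the first branch answers; blocks are
  nonempty, so this value never enters a moment.\<close>

definition mix :: "('a list \<Rightarrow> 'k) \<Rightarrow> ('a list \<Rightarrow> 'k) \<Rightarrow> (side \<times> 'a) list \<Rightarrow> 'k::comm_ring_1" where
  "mix \<xi> \<eta> u = (if \<forall>z\<in>set u. fst z = X then \<xi> (map snd u)
     else if \<forall>z\<in>set u. fst z = Y then \<eta> (map snd u) else 0)"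

lemma mix_Pair: "a \<noteq> [] \<Longrightarrow> mix \<xi> \<eta> (map (Pair e) a) = (case e of X \<Rightarrow> \<xi> | Y \<Rightarrow> \<eta>) a"
  by (cases e; cases a) (auto simp: mix_def comp_def)

lemma mom_mix_Pair: "mom i (mix \<xi> \<eta>) (map (Pair e) a) = mom i (case e of X \<Rightarrow> \<xi> | Y \<Rightarrow> \<eta>) a"
  by (auto simp: mom_def nths_map mix_Pair nths_block intro!: sum.cong prod.cong)

lemma mix_nths_eq_0:
  assumes "p \<in> B" "q \<in> B" "p < length u" "q < length u" "fst (u ! p) \<noteq> fst (u ! q)"
  shows "mix \<xi> \<eta> (nths u B) = 0"
proof -
  have "u ! p \<in> set (nths u B)" "u ! q \<in> set (nths u B)"
    using assms by (auto simp: set_nths)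
  then have "\<not> (\<forall>z\<in>set (nths u B). fst z = e)" for e using assms(5) by metis
  then show ?thesis by (simp only: mix_def if_False)
qed

lemma prod_mix_eq_0:
  assumes "\<pi> \<in> parts i {..<length u}" "B \<in> \<pi>" "p \<in> B" "q \<in> B" "fst (u ! p) \<noteq> fst (u ! q)"
  shows "(\<Prod>B\<in>\<pi>. mix \<xi> \<eta> (nths u B)) = 0"
  using assms parts_block[OF assms(1,2)] parts_finite[OF assms(1)]
  by (intro prod_zero bexI[of _ B] mix_nths_eq_0) auto

section \<open>Tensor and boolean products have mixed cumulants\<close>

lemma filter_flatten:
  "filter (\<lambda>z. fst z = e) (flatten bs) = map (Pair e) (concat (map snd (filter (\<lambda>b. fst b = e) bs)))"
proof (induction bs)
  case (Cons b bs)
  obtain e' a where "b = (e', a)" by (cases b)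
  then show ?case using Cons by (auto simp: filter_map comp_def)
qed (simp add: flatten_def)

text \<open>A block meeting both sides has weight 0, so the set \<open>A\<close> of x-positions is
  saturated by all partitions that count, and in the tensor case any set of positions splits off.
  The bounds \<open>L\<close> and \<open>n\<close> describe where truncated functionals still agree
  with moments.\<close>

lemma tensor_product_mom:
  assumes f: "\<And>v. v \<noteq> [] \<Longrightarrow> set v \<subseteq> L \<Longrightarrow> length v \<le> n \<Longrightarrow> f v = mom Tensor \<xi> v"
    and g: "\<And>v. v \<noteq> [] \<Longrightarrow> set v \<subseteq> L \<Longrightarrow> length v \<le> n \<Longrightarrow> g v = mom Tensor \<eta> v"
    and u: "set (map snd u) \<subseteq> L" "length u \<le> n"
  shows "tensor_product f g u = mom Tensor (mix \<xi> \<eta>) u"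
proof -
  define part where "part e = concat (map snd (filter (\<lambda>b. fst b = e) (blocks u)))" for e
  define A where "A = {j. j < length u \<and> fst (u ! j) = X}"
  have part: "filter (\<lambda>z. fst z = e) u = map (Pair e) (part e)" for e
    using filter_flatten[of e "blocks u"] by (simp add: part_def)
  have part': "part e = map snd (filter (\<lambda>z. fst z = e) u)" for e
    by (simp add: part comp_def)
  have partL: "set (part e) \<subseteq> L \<and> length (part e) \<le> n" for e
    using u le_trans[OF length_filter_le[of "\<lambda>z. fst z = e" u]] by (auto simp: part')
  have fX: "(if part X = [] then 1 else f (part X)) = mom Tensor (mix \<xi> \<eta>) (map (Pair X) (part X))"
    using f[of "part X"] partL[of X] by (simp add: mom_mix_Pair)
  have gY: "(if part Y = [] then 1 else g (part Y)) = mom Tensor (mix \<xi> \<eta>) (map (Pair Y) (part Y))"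
    using g[of "part Y"] partL[of Y] by (simp add: mom_mix_Pair)
  have X: "map (Pair X) (part X) = nths u A"
    by (simp add: A_def filter_eq_nths flip: part)
  have "{j. j < length u \<and> fst (u ! j) = Y} = {..<length u} - A"
    unfolding A_def by (auto, metis side.exhaust)
  then have Y: "map (Pair Y) (part Y) = nths u ({..<length u} - A)"
    by (simp add: filter_eq_nths flip: part)
  have "A \<subseteq> {..<length u}" by (auto simp: A_def)
  moreover have "splits Tensor A {..<length u}" using \<open>A \<subseteq> _\<close> by (simp add: splits_def)
  moreover have "(\<Prod>B\<in>\<pi>. mix \<xi> \<eta> (nths u B)) = 0"
    if pi: "\<pi> \<in> parts Tensor {..<length u}" and sat: "\<not> saturated A \<pi>" for \<pi>
  proof -
    obtain B p q where B: "B \<in> \<pi>" "p \<in> B" "q \<in> B" "p \<in> A" "q \<notin> A"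
      using sat by (auto simp: saturated_def)
    then have "q < length u" using parts_block[OF pi] by blast
    then have "fst (u ! p) \<noteq> fst (u ! q)" using B by (auto simp: A_def)
    then show ?thesis using B by (intro prod_mix_eq_0[OF pi])
  qed
  ultimately have "mom Tensor (mix \<xi> \<eta>) u
      = mom Tensor (mix \<xi> \<eta>) (nths u A) * mom Tensor (mix \<xi> \<eta>) (nths u ({..<length u} - A))"
    by (simp add: mom_set_mom[of _ _ u] mom_nths_set_mom set_mom_split)
  moreover have "tensor_product f g u
      = (if part X = [] then 1 else f (part X)) * (if part Y = [] then 1 else g (part Y))"
    by (simp only: tensor_product_def part_def Let_def)
  ultimately show ?thesis by (simp only: fX gY X Y)
qed

text \<open>The first run can be split off: an interval block that leaves it contains the last
  position of this run and the first of the next one, which lie on different sides, so its weight is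
  0.\<close>

lemma boolean_mom_flatten:
  assumes "successively (\<lambda>b c. fst b \<noteq> fst c) bs" and "\<forall>b\<in>set bs. snd b \<noteq> []"
  shows "mom Boolean (mix \<xi> \<eta>) (flatten bs)
    = prod_list (map (\<lambda>b. mom Boolean (case fst b of X \<Rightarrow> \<xi> | Y \<Rightarrow> \<eta>) (snd b)) bs)"
  using assms
proof (induction bs)
  case Nil
  then show ?case by simp
next
  case (Cons b bs)
  obtain e a where b: "b = (e, a)" by (cases b)
  define u where "u = flatten (b # bs)"
  define A where "A = {..<length a}"
  have u: "u = map (Pair e) a @ flatten bs" by (simp add: u_def b)
  have a: "a \<noteq> []" using Cons.prems(2) b by auto
  have IH: "mom Boolean (mix \<xi> \<eta>) (flatten bs)
      = prod_list (map (\<lambda>b. mom Boolean (case fst b of X \<Rightarrow> \<xi> | Y \<Rightarrow> \<eta>) (snd b)) bs)"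
    using Cons by (auto simp: successively_Cons)
  have zero: "(\<Prod>B\<in>\<pi>. mix \<xi> \<eta> (nths u B)) = 0"
    if pi: "\<pi> \<in> parts Boolean {..<length u}" and sat: "\<not> saturated A \<pi>" for \<pi>
  proof -
    obtain B p q where B: "B \<in> \<pi>" "p \<in> B" "q \<in> B" "p < length a" "length a \<le> q"
      using sat by (auto simp: saturated_def A_def not_less)
    have q: "q < length u" using B parts_block[OF pi] by blast
    have mem: "r \<in> B" if r: "p \<le> r" "r \<le> q" for r
    proof (cases "r = p \<or> r = q")
      case False
      have "r \<in> {..<length u}" using r q by simp
      then obtain C where C: "C \<in> \<pi>" "r \<in> C" using parts_Union[OF pi] by blast
      have "admissible Boolean \<pi>" using pi by (simp add: parts_def)
      then have "B = C" using B C False r unfolding admissible.simps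
        by (metis le_neq_implies_less)
      then show ?thesis using C by simp
    qed (use B in auto)
    have "flatten bs \<noteq> []" using q B(5) by (auto simp: u)
    then obtain b' bs' where bs: "bs = b' # bs'" by (cases bs) auto
    obtain e' a' where b': "b' = (e', a')" by (cases b')
    have "a' \<noteq> []" "e \<noteq> e'" using Cons.prems bs b b' by auto
    then have "fst (u ! (length a - 1)) \<noteq> fst (u ! length a)"
      using a by (cases a') (simp_all add: u nth_append bs b')
    moreover have "length a - 1 \<in> B" "length a \<in> B" using B a by (auto intro!: mem)
    ultimately show ?thesis using B(1) by (intro prod_mix_eq_0[OF pi])
  qed
  have "A \<subseteq> {..<length u}" by (auto simp: A_def u)
  moreover have "splits Boolean A {..<length u}" using \<open>A \<subseteq> _\<close> by (auto simp: splits_def A_def)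
  ultimately have "mom Boolean (mix \<xi> \<eta>) u
      = mom Boolean (mix \<xi> \<eta>) (nths u A) * mom Boolean (mix \<xi> \<eta>) (nths u ({..<length u} - A))"
    using zero by (simp add: mom_set_mom[of _ _ u] mom_nths_set_mom set_mom_split)
  moreover have "nths u A = map (Pair e) a"
    by (simp add: u A_def)
  moreover have "nths u ({..<length u} - A) = flatten bs"
  proof -
    have "nths u ({..<length u} - A) = nths (map (Pair e) a) ({..<length u} - A)
        @ nths (flatten bs) {j. j + length a \<in> {..<length u} - A}"
      by (simp add: u nths_append)
    moreover have "nths (map (Pair e) a) ({..<length u} - A) = []"
      by (auto simp: A_def nths_def filter_empty_conv set_zip)
    moreover have "nths (flatten bs) {j. j + length a \<in> {..<length u} - A} = flatten bs"
      by (intro nths_all) (auto simp: A_def u)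
    ultimately show ?thesis by simp
  qed
  ultimately show ?case using IH by (simp add: mom_mix_Pair b u)
qed

lemma set_blocks: "(e, a) \<in> set (blocks u) \<Longrightarrow> set a \<subseteq> set (map snd u) \<and> length a \<le> length u"
proof -
  assume ea: "(e, a) \<in> set (blocks u)"
  then obtain bs cs where "blocks u = bs @ (e, a) # cs" by (meson split_list)
  then have "u = flatten bs @ map (Pair e) a @ flatten cs"
    by (metis flatten_blocks flatten_simps(2) flatten_def concat_append map_append)
  then show ?thesis by force
qed

lemma boolean_product_mom:
  assumes f: "\<And>v. v \<noteq> [] \<Longrightarrow> set v \<subseteq> L \<Longrightarrow> length v \<le> n \<Longrightarrow> f v = mom Boolean \<xi> v"
    and g: "\<And>v. v \<noteq> [] \<Longrightarrow> set v \<subseteq> L \<Longrightarrow> length v \<le> n \<Longrightarrow> g v = mom Boolean \<eta> v"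
    and u: "set (map snd u) \<subseteq> L" "length u \<le> n"
  shows "boolean_product f g u = mom Boolean (mix \<xi> \<eta>) u"
proof -
  \<comment> \<open>Commutativity of the scalars merges the two products into a single one over the
    runs in their order.\<close>
  have split: "prod_list (map (\<lambda>b. f (snd b)) (filter (\<lambda>b. fst b = X) bs))
      * prod_list (map (\<lambda>b. g (snd b)) (filter (\<lambda>b. fst b = Y) bs))
      = prod_list (map (\<lambda>b. (case fst b of X \<Rightarrow> f | Y \<Rightarrow> g) (snd b)) bs)" for bs
    by (induction bs) (auto simp: mult_ac split: side.splits)
  have "(case fst b of X \<Rightarrow> f | Y \<Rightarrow> g) (snd b) = mom Boolean (case fst b of X \<Rightarrow> \<xi> | Y \<Rightarrow> \<eta>) (snd b)"
    if "b \<in> set (blocks u)" for b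
  proof -
    obtain e a where b: "b = (e, a)" by (cases b)
    then have "a \<noteq> []" "set a \<subseteq> L" "length a \<le> n"
      using that u blocks_nonempty[of e a u] set_blocks[of e a u] by auto
    then show ?thesis using f g b by (auto split: side.split)
  qed
  then have "boolean_product f g u
      = prod_list (map (\<lambda>b. mom Boolean (case fst b of X \<Rightarrow> \<xi> | Y \<Rightarrow> \<eta>) (snd b)) (blocks u))"
    by (simp add: boolean_product_def split cong: map_cong)
  also have "\<dots> = mom Boolean (mix \<xi> \<eta>) (flatten (blocks u))"
    by (rule boolean_mom_flatten[symmetric]) (auto simp: successively_blocks dest: blocks_nonempty)
  finally show ?thesis by simp
qed

section \<open>The free product\<close>

text \<open>The sets \<open>A j\<close> are removed one at a time. Each is an interval, hence convex
  in whatever remains of \<open>V\<close>, and being disjoint from it the other sets keep their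
  saturation condition on the remaining blocks.\<close>

lemma sum_saturated_family:
  assumes "finite J" and "finite V"
    and "\<And>j. j \<in> J \<Longrightarrow> A j \<subseteq> V"
    and "\<And>j k. j \<in> J \<Longrightarrow> k \<in> J \<Longrightarrow> j \<noteq> k \<Longrightarrow> A j \<inter> A k = {}"
    and "\<And>j. j \<in> J \<Longrightarrow> A j = {l j..<r j}"
  shows "(\<Sum>\<pi>\<in>{\<pi> \<in> parts Free V. \<forall>j\<in>J. saturated (A j) \<pi>}. prod h \<pi>)
    = set_mom Free h (V - (\<Union>j\<in>J. A j)) * (\<Prod>j\<in>J. set_mom Free h (A j))"
  using assms
proof (induction J arbitrary: V rule: finite_induct)
  case empty
  then show ?case by (simp add: set_mom_def)
next
  case (insert j J)
  \<comment> \<open>The conditions for the other runs are hidden in the summand, so that splitting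
    off \<open>A j\<close> is an instance of \<open>sum_parts_split\<close>.\<close>
  define F where "F \<pi> = (if \<forall>k\<in>J. saturated (A k) \<pi> then prod h \<pi> else 0)" for \<pi>
  have splits: "splits Free (A j) V"
    using insert.prems(2,4)[of j] by (auto simp: splits_def)
  have disj: "A k \<inter> A j = {}" if "k \<in> J" for k
    using insert.prems(3)[of k j] insert.hyps(2) that by auto
  have AV: "A j \<subseteq> V" using insert.prems(2) by simp
  have F: "F (\<pi> \<union> \<rho>) = prod h \<pi> * F \<rho>" if p: "\<pi> \<in> parts Free (A j)" and q: "\<rho> \<in> parts Free (V - A j)" for \<pi> \<rho>
  proof -
    have "saturated (A k) (\<pi> \<union> \<rho>) \<longleftrightarrow> saturated (A k) \<rho>" if "k \<in> J" for k
      using disj[OF that] parts_block[OF p] unfolding saturated_def by blast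
    then show ?thesis
      by (auto simp: F_def prod_parts_join[OF insert.prems(1) p q AV])
  qed
  have "(\<Sum>\<pi>\<in>{\<pi> \<in> parts Free V. \<forall>k\<in>insert j J. saturated (A k) \<pi>}. prod h \<pi>)
      = (\<Sum>\<pi>\<in>{\<pi> \<in> parts Free V. saturated (A j) \<pi>}. F \<pi>)"
    using insert.prems(1) by (intro sum.mono_neutral_cong_left) (auto simp: F_def finite_parts)
  also have "\<dots> = (\<Sum>\<pi>\<in>parts Free (A j). \<Sum>\<rho>\<in>parts Free (V - A j). prod h \<pi> * F \<rho>)"
    by (simp add: sum_parts_split[OF splits] F)
  also have "\<dots> = set_mom Free h (A j) * (\<Sum>\<rho>\<in>parts Free (V - A j). F \<rho>)"
    by (simp add: set_mom_def sum_product)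
  also have "(\<Sum>\<rho>\<in>parts Free (V - A j). F \<rho>)
      = (\<Sum>\<rho>\<in>{\<rho> \<in> parts Free (V - A j). \<forall>k\<in>J. saturated (A k) \<rho>}. prod h \<rho>)"
    using insert.prems(1) by (intro sum.mono_neutral_cong_right) (auto simp: F_def finite_parts)
  also have "\<dots> = set_mom Free h (V - A j - (\<Union>k\<in>J. A k)) * (\<Prod>k\<in>J. set_mom Free h (A k))"
  proof (rule insert.IH)
    show "finite (V - A j)" using insert.prems(1) by simp
    show "A k \<subseteq> V - A j" if "k \<in> J" for k
      using insert.prems(2)[of k] disj[OF that] that by blast
    show "A k \<inter> A k' = {}" if "k \<in> J" "k' \<in> J" "k \<noteq> k'" for k k'
      using insert.prems(3)[of k k'] that by blast
    show "A k = {l k..<r k}" if "k \<in> J" for k using insert.prems(4)[of k] that by blast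
  qed
  also have "V - A j - (\<Union>k\<in>J. A k) = V - (\<Union>k\<in>insert j J. A k)" by auto
  finally show ?case using insert.hyps by (simp add: mult_ac)
qed

text \<open>A noncrossing partition that respects an alternating colouring contains a whole run: between two
  elements of one block in different runs, chosen at minimal distance, lies a run that no block can
  leave without crossing.\<close>

lemma exists_saturated_run:
  fixes b :: "nat \<Rightarrow> nat" and c :: "nat \<Rightarrow> side"
  assumes \<pi>: "\<pi> \<in> parts Free {..<b m}" and "m > 0" and b0: "b 0 = 0"
    and b: "\<And>i. i < m \<Longrightarrow> b i < b (Suc i)"
    and run: "\<And>i p. i < m \<Longrightarrow> b i \<le> p \<Longrightarrow> p < b (Suc i) \<Longrightarrow> c p = col i"
    and alt: "\<And>i. Suc i < m \<Longrightarrow> col i \<noteq> col (Suc i)"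
    and mono: "\<And>B p q. B \<in> \<pi> \<Longrightarrow> p \<in> B \<Longrightarrow> q \<in> B \<Longrightarrow> c p = c q"
  shows "\<exists>i<m. saturated {b i..<b (Suc i)} \<pi>"
proof (rule ccontr)
  define A where "A i = {b i..<b (Suc i)}" for i
  assume "\<not> ?thesis"
  then have ns: "\<exists>B\<in>\<pi>. \<exists>p\<in>B. \<exists>q\<in>B. p \<in> A i \<and> q \<notin> A i" if "i < m" for i
    using that unfolding saturated_def A_def by blast
  \<comment> \<open>\<open>Q d\<close>: some block has two elements at distance \<open>d\<close> in
    different runs. A witness is ordered from left to right and the run is that of its left
    element.\<close>
  define Q where "Q d \<longleftrightarrow> (\<exists>B\<in>\<pi>. \<exists>p\<in>B. \<exists>q\<in>B. \<exists>i<m. p < q \<and> q - p = d \<and> p \<in> A i \<and> q \<notin> A i)" for d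
  have cover: "\<exists>i<m. p \<in> A i" if "p < b m" for p
  proof -
    have "\<forall>p<b k. \<exists>i<k. p \<in> A i" if "k \<le> m" for k using that
    proof (induction k)
      case (Suc k)
      show ?case
      proof (intro allI impI)
        fix p assume "p < b (Suc k)"
        then show "\<exists>i<Suc k. p \<in> A i"
          using Suc by (cases "p < b k") (auto simp: A_def intro: less_SucI)
      qed
    qed (simp add: b0)
    then show ?thesis using that by blast
  qed
  have bmono: "b i \<le> b k" if "i \<le> k" "k \<le> m" for i k
    using that
  proof (induction k)
    case (Suc k)
    then show ?case using b[of k] by (cases "i = Suc k") (auto intro: order.trans less_imp_le)
  qed simp
  obtain B p q where "B \<in> \<pi>" "p \<in> B" "q \<in> B" "p \<in> A 0" "q \<notin> A 0" using ns[of 0] \<open>m > 0\<close> by blast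
  then have "p < q" by (auto simp: A_def b0)
  then have "Q (q - p)" using \<open>B \<in> \<pi>\<close> \<open>p \<in> B\<close> \<open>q \<in> B\<close> \<open>p \<in> A 0\<close> \<open>q \<notin> A 0\<close> \<open>m > 0\<close>
    unfolding Q_def by blast
  define d where "d = (LEAST d. Q d)"
  have "Q d" unfolding d_def using \<open>Q (q - p)\<close> by (rule LeastI)
  have least: "d \<le> q - p" if "B \<in> \<pi>" "p \<in> B" "q \<in> B" "i < m" "p < q" "p \<in> A i" "q \<notin> A i" for B p q i
    unfolding d_def using that by (intro Least_le) (auto simp: Q_def)
  obtain B p q i where B: "B \<in> \<pi>" "p \<in> B" "q \<in> B" "i < m" "p < q" "q - p = d" "p \<in> A i" "q \<notin> A i"
    using \<open>Q d\<close> unfolding Q_def by blast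
  have q: "q < b m" using B parts_block[OF \<pi>] by blast
  have q1: "b (Suc i) \<le> q" using B by (auto simp: A_def)
  then have im: "Suc i < m" using q B(4) by (metis not_less Suc_lessI)
  \<comment> \<open>Neighbouring runs have different colours while \<open>p\<close> and
    \<open>q\<close> share theirs. So the whole run \<open>Suc i\<close> lies between
    \<open>p\<close> and \<open>q\<close>, and the block \<open>C\<close> leaving it is the one that
    must cross.\<close>
  have "q \<notin> A (Suc i)"
  proof
    assume "q \<in> A (Suc i)"
    then have "c q = col (Suc i)" "c p = col i" using run im B by (auto simp: A_def)
    then show False using mono[OF B(1-3)] alt[OF im] by simp
  qed
  then have q2: "b (Suc (Suc i)) \<le> q" using q1 by (auto simp: A_def)
  obtain C r r' where C: "C \<in> \<pi>" "r \<in> C" "r' \<in> C" "r \<in> A (Suc i)" "r' \<notin> A (Suc i)"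
    using ns[OF im] by blast
  have pr: "p < r" "r < q" "r \<notin> A i" using B C q2 by (auto simp: A_def)
  have "C \<noteq> B"
  proof
    assume "C = B"
    then have "d \<le> r - p" using least[of B p r i] B C pr by simp
    then show False using pr B by simp
  qed
  have nc: "E = D" if "E \<in> \<pi>" "D \<in> \<pi>" "x \<in> E" "y \<in> D" "z \<in> E" "w \<in> D" "x < y" "y < z" "z < w" for E D x y z w
  proof -
    have "admissible Free \<pi>" using \<pi> by (simp add: parts_def)
    then show ?thesis using that by (simp, blast)
  qed
  show False
  \<comment> \<open>Minimality puts \<open>r'\<close> at distance at least \<open>d = q - p\<close>
    from \<open>r\<close>, and \<open>p < r < q\<close>. So \<open>r'\<close> lies beyond
    \<open>q\<close> if it is to the right of \<open>r\<close>, and before \<open>p\<close> if it is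
    to the left; either way \<open>B\<close> and \<open>C\<close> cross.\<close>
  proof (cases "r < r'")
    case True
    then have "d \<le> r' - r" using least[of C r r' "Suc i"] C im by simp
    then have "q < r'" using True B(5,6) pr by linarith
    then show False using nc[of B C p r q r'] B C pr \<open>C \<noteq> B\<close> by blast
  next
    case False
    then have "r' < r" using C by (metis linorder_neqE_nat)
    have "r' < b m" using C parts_block[OF \<pi>] by blast
    then obtain k where k: "k < m" "r' \<in> A k" using cover by blast
    have "r \<notin> A k"
    proof
      assume "r \<in> A k"
      then have "k = Suc i"
        using C(4) bmono[of "Suc k" "Suc i"] bmono[of "Suc (Suc i)" k] k im
        by (cases k "Suc i" rule: linorder_cases) (auto simp: A_def)
      then show False using k C by simp
    qed
    then have "d \<le> r - r'" using least[of C r' r k] C k \<open>r' < r\<close> by simp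
    then have "r' < p" using \<open>r' < r\<close> B(5,6) pr by linarith
    then show False using nc[of C B r' p r q] B C pr \<open>C \<noteq> B\<close> by blast
  qed
qed

section \<open>Runs of a word as intervals of positions\<close>

definition bdry :: "(side \<times> 'a list) list \<Rightarrow> nat \<Rightarrow> nat" where
  "bdry bs i = length (flatten (take i bs))"

lemma bdry_0 [simp]: "bdry bs 0 = 0"
  by (simp add: bdry_def)

lemma bdry_Cons_Suc [simp]: "bdry ((e, a) # bs) (Suc i) = length a + bdry bs i"
  by (simp add: bdry_def)

lemma bdry_mono: "i \<le> j \<Longrightarrow> bdry bs i \<le> bdry bs j"
proof (induction bs arbitrary: i j)
  case (Cons b bs)
  then show ?case by (cases b; cases i; cases j) auto
qed (simp add: bdry_def)

lemma bdry_length: "length bs \<le> i \<Longrightarrow> bdry bs i = length (flatten bs)"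
  by (simp add: bdry_def)

lemma bdry_Suc: "i < length bs \<Longrightarrow> bdry bs (Suc i) = bdry bs i + length (snd (bs ! i))"
  by (simp add: bdry_def take_Suc_conv_app_nth flatten_def case_prod_unfold)

text \<open>Translates the words of the free recursion into sets of positions: keeping the runs in
  \<open>I\<close> is keeping their intervals, however the remaining letters regroup. Indices beyond
  the last run contribute empty intervals.\<close>

lemma nths_flatten:
  "nths (flatten bs) (\<Union>i\<in>I. {bdry bs i..<bdry bs (Suc i)}) = flatten (nths bs I)"
proof (induction bs arbitrary: I)
  case Nil
  then show ?case by simp
next
  case (Cons b bs)
  obtain e a where b: "b = (e, a)" by (cases b)
  define S where "S = (\<Union>i\<in>I. {bdry (b # bs) i..<bdry (b # bs) (Suc i)})"
  have S: "j + length a \<in> S \<longleftrightarrow> j \<in> (\<Union>i\<in>{i. Suc i \<in> I}. {bdry bs i..<bdry bs (Suc i)})" for j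
  proof
    assume "j + length a \<in> S"
    then obtain i where i: "i \<in> I" "j + length a \<in> {bdry (b # bs) i..<bdry (b # bs) (Suc i)}"
      by (auto simp: S_def)
    then show "j \<in> (\<Union>i\<in>{i. Suc i \<in> I}. {bdry bs i..<bdry bs (Suc i)})"
      by (cases i) (auto simp: b)
  next
    assume "j \<in> (\<Union>i\<in>{i. Suc i \<in> I}. {bdry bs i..<bdry bs (Suc i)})"
    then obtain i where "Suc i \<in> I" "j \<in> {bdry bs i..<bdry bs (Suc i)}" by auto
    then show "j + length a \<in> S" unfolding S_def b by (auto intro!: bexI[of _ "Suc i"])
  qed
  have S': "j \<in> S \<longleftrightarrow> 0 \<in> I" if "j < length a" for j
  proof
    assume "j \<in> S"
    then obtain i where i: "i \<in> I" "j \<in> {bdry (b # bs) i..<bdry (b # bs) (Suc i)}"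
      by (auto simp: S_def)
    then show "0 \<in> I" using that by (cases i) (auto simp: b)
  next
    assume "0 \<in> I"
    then show "j \<in> S" using that unfolding S_def b by (auto intro!: bexI[of _ 0])
  qed
  have "nths (map (Pair e) a) S = (if 0 \<in> I then map (Pair e) a else [])"
  proof (cases "0 \<in> I")
    case True
    then show ?thesis using S' by (simp add: nths_all)
  next
    case False
    then show ?thesis using S' by (auto simp: nths_def filter_empty_conv set_zip)
  qed
  then have "nths (flatten (b # bs)) S = (if 0 \<in> I then map (Pair e) a else [])
      @ nths (flatten bs) (\<Union>i\<in>{i. Suc i \<in> I}. {bdry bs i..<bdry bs (Suc i)})"
    by (simp only: b flatten_simps nths_append length_map S Collect_mem_eq)
  then show ?case by (simp add: Cons.IH nths_Cons b S_def)
qed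

lemma nths_flatten_block:
  assumes "i < length bs"
  shows "nths (flatten bs) {bdry bs i..<bdry bs (Suc i)} = map (Pair (fst (bs ! i))) (snd (bs ! i))"
proof -
  have "nths bs {i} = [bs ! i]"
    using assms
  proof (induction bs arbitrary: i)
    case (Cons b bs)
    then show ?case by (cases i) (simp_all add: nths_Cons)
  qed simp
  then show ?thesis using nths_flatten[of bs "{i}"] by (simp add: flatten_def case_prod_unfold)
qed

lemma UN_bdry: "(\<Union>i<k. {bdry bs i..<bdry bs (Suc i)}) = {..<bdry bs k}"
proof (induction k)
  case (Suc k)
  then show ?case using bdry_mono[of k "Suc k" bs] by (auto simp: lessThan_Suc)
qed simp

lemma bdry_disjoint:
  assumes "i \<noteq> j"
  shows "{bdry bs i..<bdry bs (Suc i)} \<inter> {bdry bs j..<bdry bs (Suc j)} = {}"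
  using assms bdry_mono[of "Suc i" j bs] bdry_mono[of "Suc j" i bs]
  by (cases i j rule: linorder_cases) auto

text \<open>Multiply out the product of \<open>- 1 + 1\<close> over \<open>S\<close>.\<close>

lemma sum_Pow_neg_1:
  assumes "finite S"
  shows "(\<Sum>J\<in>Pow S. (- 1) ^ card J :: 'k::comm_ring_1) = (if S = {} then 1 else 0)"
proof -
  have "(\<Prod>x\<in>S. - 1 + 1 :: 'k) = (\<Sum>J\<in>Pow S. (\<Prod>x\<in>J. - 1) * (\<Prod>x\<in>S - J. 1))"
    by (rule prod_add[OF assms])
  then show ?thesis using assms by (auto simp: power_0_left card_0_eq)
qed

lemma UN_disjoint_Diff:
  assumes "\<And>i j. i \<noteq> j \<Longrightarrow> A i \<inter> A j = {}" and "I \<subseteq> K"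
  shows "(\<Union>i\<in>I. A i) = (\<Union>i\<in>K. A i) - (\<Union>j\<in>K - I. A j)"
proof (intro equalityI subsetI)
  fix x assume "x \<in> (\<Union>i\<in>I. A i)"
  then obtain i where i: "i \<in> I" "x \<in> A i" by blast
  have "x \<notin> A j" if "j \<in> K - I" for j
    using assms(1)[of i j] i that by blast
  then show "x \<in> (\<Union>i\<in>K. A i) - (\<Union>j\<in>K - I. A j)" using i assms(2) by blast
qed blast

text \<open>After exchanging the sums, each partition is counted with the alternating sum over the sets of
  runs that it saturates. It vanishes unless no run is saturated, and then the product is zero.\<close>

lemma free_mom_recursion:
  fixes \<xi> \<eta> :: "'a list \<Rightarrow> 'k::comm_ring_1"
  assumes "u \<noteq> []"
  defines "bs \<equiv> blocks u" and "h \<equiv> \<lambda>B. mix \<xi> \<eta> (nths u B)"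
  defines "m \<equiv> length bs" and "A \<equiv> \<lambda>i. {bdry bs i..<bdry bs (Suc i)}"
  shows "(\<Sum>J\<in>Pow {..<m}. (- 1) ^ card J
    * (set_mom Free h ({..<length u} - (\<Union>j\<in>J. A j)) * (\<Prod>j\<in>J. set_mom Free h (A j)))) = 0"
proof -
  define V where "V = {..<length u}"
  have u: "flatten bs = u" by (simp add: bs_def)
  have V: "V = {..<bdry bs m}" by (simp add: V_def m_def bdry_length u)
  have bs: "bs \<noteq> []" using u assms(1) by force
  have ne: "snd (bs ! i) \<noteq> []" if "i < m" for i
    using blocks_nonempty[of "fst (bs ! i)" "snd (bs ! i)" u] nth_mem[of i bs] that
    by (simp add: bs_def m_def)
  have AV: "A i \<subseteq> V" if "i < m" for i using UN_bdry[of bs m] that by (auto simp: V A_def)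
  define S where "S \<pi> = {i. i < m \<and> saturated (A i) \<pi>}" for \<pi>
  have "(\<Sum>J\<in>Pow {..<m}. (- 1) ^ card J
      * (set_mom Free h (V - (\<Union>j\<in>J. A j)) * (\<Prod>j\<in>J. set_mom Free h (A j))))
    = (\<Sum>J\<in>Pow {..<m}. (- 1) ^ card J * (\<Sum>\<pi>\<in>{\<pi> \<in> parts Free V. \<forall>j\<in>J. saturated (A j) \<pi>}. prod h \<pi>))"
  proof (rule sum.cong[OF refl], rule arg_cong2[where f = "(*)", OF refl], rule sum_saturated_family[symmetric])
    fix J assume J: "J \<in> Pow {..<m}"
    then show "finite J" using finite_subset by auto
    show "finite V" by (simp add: V_def)
    show "A j \<subseteq> V" if "j \<in> J" for j using AV J that by auto
    show "A j \<inter> A k = {}" if "j \<noteq> k" for j k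
      using bdry_disjoint[OF that] by (simp add: A_def)
  qed (simp add: A_def)
  also have "\<dots> = (\<Sum>J\<in>Pow {..<m}. \<Sum>\<pi>\<in>parts Free V. if J \<subseteq> S \<pi> then (- 1) ^ card J * prod h \<pi> else 0)"
  proof (rule sum.cong[OF refl])
    fix J assume J: "J \<in> Pow {..<m}"
    then have "(\<forall>j\<in>J. saturated (A j) \<pi>) \<longleftrightarrow> J \<subseteq> S \<pi>" for \<pi> by (auto simp: S_def)
    then show "(- 1) ^ card J * (\<Sum>\<pi>\<in>{\<pi> \<in> parts Free V. \<forall>j\<in>J. saturated (A j) \<pi>}. prod h \<pi>)
      = (\<Sum>\<pi>\<in>parts Free V. if J \<subseteq> S \<pi> then (- 1) ^ card J * prod h \<pi> else 0)"
      by (simp add: sum_distrib_left sum.If_cases finite_parts V_def Int_def)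
  qed
  also have "\<dots> = (\<Sum>\<pi>\<in>parts Free V. \<Sum>J\<in>Pow {..<m}. if J \<subseteq> S \<pi> then (- 1) ^ card J * prod h \<pi> else 0)"
    by (rule sum.swap)
  also have "\<dots> = 0"
  proof (rule sum.neutral, rule ballI)
    fix \<pi> assume pi: "\<pi> \<in> parts Free V"
    have fin: "finite (S \<pi>)" by (simp add: S_def)
    have "(\<Sum>J\<in>Pow {..<m}. if J \<subseteq> S \<pi> then (- 1) ^ card J * prod h \<pi> else 0)
      = (\<Sum>J\<in>Pow (S \<pi>). (- 1) ^ card J * prod h \<pi>)"
      by (rule sum.mono_neutral_cong_right) (auto simp: S_def)
    also have "\<dots> = (if S \<pi> = {} then prod h \<pi> else 0)"
      by (simp add: sum_Pow_neg_1[OF fin] flip: sum_distrib_right)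
    also have "\<dots> = 0"
    proof (cases "S \<pi> = {}")
      case True
      show ?thesis
      proof (rule ccontr)
        assume "\<not> ?thesis"
        then have nz: "prod h \<pi> \<noteq> 0" using True by simp
        \<comment> \<open>A nonzero weight forces every block onto one side, so the sides of the
          letters form an alternating colouring that the partition respects. The run found in this
          way contradicts \<open>S \<pi> = {}\<close>.\<close>
        have "\<exists>i<m. saturated {bdry bs i..<bdry bs (Suc i)} \<pi>"
        proof (rule exists_saturated_run[where c = "\<lambda>p. fst (u ! p)" and col = "\<lambda>i. fst (bs ! i)"])
          show "\<pi> \<in> parts Free {..<bdry bs m}" using pi by (simp add: V)
          show "m > 0" using bs by (simp add: m_def)
          show "bdry bs i < bdry bs (Suc i)" if "i < m" for i
            using that ne[OF that] by (simp add: bdry_Suc m_def)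
          show "fst (bs ! i) \<noteq> fst (bs ! Suc i)" if "Suc i < m" for i
            using successively_blocks[of u] that
            by (simp add: successively_conv_nth bs_def m_def)
          show "fst (u ! p) = fst (bs ! i)"
            if i: "i < m" "bdry bs i \<le> p" "p < bdry bs (Suc i)" for i p
          proof -
            have "p \<in> V" using AV[OF i(1)] i by (auto simp: A_def)
            then have "u ! p \<in> set (nths u {bdry bs i..<bdry bs (Suc i)})"
              using i by (auto simp: set_nths V_def)
            then show ?thesis using nths_flatten_block[of i bs] i(1) by (auto simp: u m_def)
          qed
          show "fst (u ! p) = fst (u ! q)" if "B \<in> \<pi>" "p \<in> B" "q \<in> B" for B p q
          proof (rule ccontr)
            assume "\<not> ?thesis"
            then have "prod h \<pi> = 0"
              unfolding h_def using pi that by (intro prod_mix_eq_0[of \<pi> Free u B p q]) (auto simp: V_def)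
            then show False using nz by simp
          qed
        qed simp
        then show False using True by (auto simp: S_def A_def)
      qed
    qed simp
    finally show "(\<Sum>J\<in>Pow {..<m}. if J \<subseteq> S \<pi> then (- 1) ^ card J * prod h \<pi> else 0) = 0" .
  qed
  finally show ?thesis by (simp add: V_def)
qed

text \<open>The words inside the recursion are shorter, so by induction they are mixed moments. The
  mixed moments satisfy the same recursion, by \<open>free_mom_recursion\<close>, and the two sides
  agree.\<close>

lemma free_product_mom:
  assumes f: "\<And>v. v \<noteq> [] \<Longrightarrow> set v \<subseteq> L \<Longrightarrow> length v \<le> n \<Longrightarrow> f v = mom Free \<xi> v"
    and g: "\<And>v. v \<noteq> [] \<Longrightarrow> set v \<subseteq> L \<Longrightarrow> length v \<le> n \<Longrightarrow> g v = mom Free \<eta> v"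
    and "set (map snd u) \<subseteq> L" "length u \<le> n"
  shows "free_product f g u = mom Free (mix \<xi> \<eta>) u"
  using assms(3,4)
proof (induction "length u" arbitrary: u rule: less_induct)
  case less
  show ?case
  proof (cases "u = []")
    case True
    then show ?thesis by (simp add: free_product.simps)
  next
    case False
    define bs where "bs = blocks u"
    define m where "m = length bs"
    define h where "h B = mix \<xi> \<eta> (nths u B)" for B
    define A where "A i = {bdry bs i..<bdry bs (Suc i)}" for i
    \<comment> \<open>\<open>J\<close> is the set of runs pulled out and evaluated separately, the
      complement of the index set \<open>I\<close> of the defining recursion.\<close>
    define T where "T J = set_mom Free h ({..<length u} - (\<Union>j\<in>J. A j)) * (\<Prod>j\<in>J. set_mom Free h (A j))" for J
    have u: "flatten bs = u" by (simp add: bs_def)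
    have V: "{..<length u} = (\<Union>i<m. A i)"
      by (simp add: A_def UN_bdry m_def bdry_length u)
    have summand: "free_product f g (flatten (nths bs I))
        * (\<Prod>i\<in>{..<m} - I. (case fst (bs ! i) of X \<Rightarrow> f | Y \<Rightarrow> g) (snd (bs ! i))) = T ({..<m} - I)"
      if I: "I \<subset> {..<m}" for I
    proof -
      have len: "length (flatten (nths bs I)) < length u"
        using length_flatten_nths_less[of bs I] I blocks_nonempty[of _ _ u]
        by (fastforce simp: u m_def simp flip: bs_def)
      have sub: "(\<Union>i\<in>I. A i) \<subseteq> {..<length u}" using I by (auto simp: V)
      have fl: "flatten (nths bs I) = nths u (\<Union>i\<in>I. A i)"
        by (simp add: A_def u flip: nths_flatten)
      have "set (map snd (flatten (nths bs I))) \<subseteq> L"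
        using less.prems(1) set_nths_subset[of u] unfolding fl by fastforce
      then have "free_product f g (flatten (nths bs I)) = mom Free (mix \<xi> \<eta>) (nths u (\<Union>i\<in>I. A i))"
        using less.hyps[OF len] len less.prems(2) fl by simp
      also have "\<dots> = set_mom Free h (\<Union>i\<in>I. A i)"
        unfolding h_def by (rule mom_nths_set_mom[OF sub])
      also have "(\<Union>i\<in>I. A i) = {..<length u} - (\<Union>j\<in>{..<m} - I. A j)"
        unfolding V using I bdry_disjoint by (intro UN_disjoint_Diff) (auto simp: A_def)
      finally have 1: "free_product f g (flatten (nths bs I))
          = set_mom Free h ({..<length u} - (\<Union>j\<in>{..<m} - I. A j))" .
      have "(case fst (bs ! i) of X \<Rightarrow> f | Y \<Rightarrow> g) (snd (bs ! i)) = set_mom Free h (A i)"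
        if "i < m" for i
      proof -
        obtain e a where ea: "bs ! i = (e, a)" by (cases "bs ! i")
        then have mem: "(e, a) \<in> set (blocks u)" using nth_mem[of i bs] that by (simp add: m_def bs_def)
        then have "a \<noteq> []" "set a \<subseteq> L" "length a \<le> n"
          using less.prems blocks_nonempty[OF mem] set_blocks[OF mem] by auto
        then have "(case e of X \<Rightarrow> f | Y \<Rightarrow> g) a = mom Free (case e of X \<Rightarrow> \<xi> | Y \<Rightarrow> \<eta>) a"
          using f g by (auto split: side.split)
        also have "\<dots> = mom Free (mix \<xi> \<eta>) (nths u (A i))"
          using nths_flatten_block[of i bs] that by (simp add: u m_def A_def ea mom_mix_Pair)
        also have "\<dots> = set_mom Free h (A i)"
          unfolding h_def using that V by (intro mom_nths_set_mom) auto
        finally show ?thesis by (simp add: ea)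
      qed
      then show ?thesis by (simp add: 1 T_def)
    qed
    have "free_product f g u = (\<Sum>I\<in>{I. I \<subset> {..<m}}. (- 1) ^ (m - card I + 1)
        * free_product f g (flatten (nths bs I))
        * (\<Prod>i\<in>{..<m} - I. (case fst (bs ! i) of X \<Rightarrow> f | Y \<Rightarrow> g) (snd (bs ! i))))"
      using False by (subst free_product.simps) (simp add: bs_def m_def)
    \<comment> \<open>The \<open>+ 1\<close> in the exponent supplies the overall minus sign, and
      \<open>m - card I\<close> is the size of the complement.\<close>
    also have "\<dots> = (\<Sum>I\<in>{I. I \<subset> {..<m}}. - ((- 1) ^ card ({..<m} - I) * T ({..<m} - I)))"
    proof (rule sum.cong[OF refl])
      fix I assume "I \<in> {I. I \<subset> {..<m}}"
      then have I: "I \<subset> {..<m}" by simp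
      then have "card ({..<m} - I) = m - card I"
        using card_Diff_subset[of I "{..<m}"] finite_subset[of I "{..<m}"] by auto
      then show "(- 1) ^ (m - card I + 1) * free_product f g (flatten (nths bs I))
          * (\<Prod>i\<in>{..<m} - I. (case fst (bs ! i) of X \<Rightarrow> f | Y \<Rightarrow> g) (snd (bs ! i)))
        = - ((- 1) ^ card ({..<m} - I) * T ({..<m} - I))"
        using summand[OF I] by (simp add: mult.assoc)
    qed
    also have "\<dots> = (\<Sum>J\<in>Pow {..<m} - {{}}. - ((- 1) ^ card J * T J))"
      by (rule sum.reindex_bij_witness[where i = "\<lambda>J. {..<m} - J" and j = "\<lambda>I. {..<m} - I"]) auto
    \<comment> \<open>Proper subsets \<open>I\<close> have nonempty complements, so only
      \<open>J = {}\<close> is missing from the full alternating sum. That sum vanishes, and the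
      value is the missing term.\<close>
    also have "\<dots> = T {} - (\<Sum>J\<in>Pow {..<m}. (- 1) ^ card J * T J)"
      by (subst (2) sum.remove[of _ "{}"]) (simp_all add: sum_negf)
    also have "(\<Sum>J\<in>Pow {..<m}. (- 1) ^ card J * T J) = 0"
      unfolding T_def h_def A_def m_def bs_def by (rule free_mom_recursion[OF False])
    also have "T {} = mom Free (mix \<xi> \<eta>) u"
      by (simp add: T_def h_def[abs_def] mom_set_mom)
    finally show ?thesis by simp
  qed
qed

lemma indep_product_mom:
  assumes "\<And>v. v \<noteq> [] \<Longrightarrow> set v \<subseteq> L \<Longrightarrow> length v \<le> n \<Longrightarrow> f v = mom i \<xi> v"
    and "\<And>v. v \<noteq> [] \<Longrightarrow> set v \<subseteq> L \<Longrightarrow> length v \<le> n \<Longrightarrow> g v = mom i \<eta> v"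
    and "set (map snd u) \<subseteq> L" "length u \<le> n"
  shows "indep_product i f g u = mom i (mix \<xi> \<eta>) u"
  using assms tensor_product_mom[of L n f \<xi> g \<eta> u] free_product_mom[of L n f \<xi> g \<eta> u]
    boolean_product_mom[of L n f \<xi> g \<eta> u]
  by (cases i) simp_all


section \<open>Additive convolution in cumulant coordinates\<close>

lemma poly_mapping_single_add_induct [case_names single add]:
  fixes p :: "'a \<Rightarrow>\<^sub>0 'b::comm_monoid_add"
  assumes "\<And>k c. P (Poly_Mapping.single k c)" and "\<And>p q. P p \<Longrightarrow> P q \<Longrightarrow> P (p + q)"
  shows "P p"
proof -
  have "p = (\<Sum>k\<in>Poly_Mapping.keys p. Poly_Mapping.single k (Poly_Mapping.lookup p k))"
    by (rule poly_mapping_eqI) (auto simp: lookup_sum lookup_single when_def in_keys_iff)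
  moreover have "P (\<Sum>k\<in>K. Poly_Mapping.single k (c k))" if "finite K" for K and c :: "'a \<Rightarrow> 'b"
    using that
  proof induction
    case empty
    then show ?case using assms(1)[of undefined 0] by simp
  qed (simp add: assms)
  ultimately show ?thesis by (metis finite_keys)
qed

lemma nc_functional_single [simp]: "nc_functional F (Poly_Mapping.single m c) = c * F (letters m)"
  by (simp add: nc_functional_def)

lemma nc_functional_add: "nc_functional F (p + q) = nc_functional F p + nc_functional F q"
  unfolding nc_functional_def by (rule setsum_keys_plus_distrib) (simp_all add: algebra_simps)

lemma nc_functional_var_times: "nc_functional F (nc_var v * p) = nc_functional (\<lambda>m. F (v # m)) p"
proof (induction p rule: poly_mapping_single_add_induct)
  case (single m c)
  then show ?case by (simp add: nc_var_def mult_single plus_free_mon_def)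
next
  case (add p q)
  then show ?case by (simp add: distrib_left nc_functional_add)
qed

section \<open>Expansion of the convolution over labellings\<close>

lemma labellings_Cons:
  "{u. map snd u = j # w} = (#) (X, j) ` {u. map snd u = w} \<union> (#) (Y, j) ` {u. map snd u = w}"
proof (intro equalityI subsetI)
  fix u :: "(side \<times> 'a) list" assume "u \<in> {u. map snd u = j # w}"
  then obtain e v where "u = (e, j) # v" "map snd v = w" by (cases u) auto
  then show "u \<in> (#) (X, j) ` {u. map snd u = w} \<union> (#) (Y, j) ` {u. map snd u = w}"
    by (cases e) auto
qed auto

lemma finite_labellings: "finite {u :: (side \<times> 'a) list. map snd u = w}"
  by (induction w) (simp_all add: labellings_Cons)

text \<open>As the variables do not commute, multiplying out yields each labelling of the letters by
  x or y exactly once. \<open>F\<close> varies in the induction because removing the leading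
  variable changes the functional.\<close>

lemma nc_functional_prod_list:
  "nc_functional F (prod_list (map (\<lambda>j. nc_var (X, j) + nc_var (Y, j)) w))
    = (\<Sum>u | map snd u = w. F u)"
proof (induction w arbitrary: F)
  case Nil
  have "nc_functional F (Poly_Mapping.single 0 1) = F []"
    by (simp add: zero_free_mon_def)
  then show ?case by simp
next
  case (Cons j w)
  have "(\<Sum>u | map snd u = j # w. F u)
      = (\<Sum>u\<in>(#) (X, j) ` {u. map snd u = w}. F u) + (\<Sum>u\<in>(#) (Y, j) ` {u. map snd u = w}. F u)"
    unfolding labellings_Cons by (rule sum.union_disjoint) (auto simp: finite_labellings)
  also have "\<dots> = (\<Sum>u | map snd u = w. F ((X, j) # u)) + (\<Sum>u | map snd u = w. F ((Y, j) # u))"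
    by (simp add: sum.reindex)
  finally show ?case
    by (simp add: distrib_right nc_functional_add nc_functional_var_times Cons.IH)
qed

text \<open>Only labellings constant on every block contribute. They correspond to the sets
  \<open>T\<close> of blocks labelled x, and the sum over \<open>T\<close> is the expansion of the
  product of the binomials.\<close>

lemma sum_labellings_prod_mix:
  assumes \<pi>: "\<pi> \<in> parts i {..<length w}"
  shows "(\<Sum>u | map snd u = w. \<Prod>B\<in>\<pi>. mix \<xi> \<eta> (nths u B))
    = (\<Prod>B\<in>\<pi>. \<xi> (nths w B) + \<eta> (nths w B))"
proof -
  define mono where "mono u \<longleftrightarrow> (\<forall>B\<in>\<pi>. \<exists>e. \<forall>p\<in>B. fst (u ! p) = e)" for u :: "(side \<times> 'a) list"
  define lab where "lab T = map (\<lambda>p. (if p \<in> \<Union>T then X else Y, w ! p)) [0..<length w]" for T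
  define col where "col u = {B \<in> \<pi>. \<forall>p\<in>B. fst (u ! p) = X}" for u :: "(side \<times> 'a) list"
  have fin: "finite \<pi>" using parts_finite[OF \<pi>] by simp
  have sub: "B \<subseteq> {..<length w}" if "B \<in> \<pi>" for B using parts_block[OF \<pi> that] .
  have len: "length u = length w" if "map snd u = w" for u :: "(side \<times> 'a) list"
    using that by auto
  have lab_nth: "lab T ! p = (if p \<in> \<Union>T then X else Y, w ! p)" if "p < length w" for T p
    using that by (simp add: lab_def)
  have fst_lab: "fst (lab T ! p) = (if B \<in> T then X else Y)" if "T \<subseteq> \<pi>" "B \<in> \<pi>" "p \<in> B" for T B p
  proof -
    have "p \<in> \<Union>T \<longleftrightarrow> B \<in> T" using parts_disjoint[OF \<pi>] that by blast
    then show ?thesis using lab_nth[of p T] sub[OF that(2)] that(3) by auto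
  qed
  have "(\<Sum>u | map snd u = w. \<Prod>B\<in>\<pi>. mix \<xi> \<eta> (nths u B))
      = (\<Sum>u\<in>{u. map snd u = w \<and> mono u}. \<Prod>B\<in>\<pi>. mix \<xi> \<eta> (nths u B))"
  proof (rule sum.mono_neutral_right)
    show "\<forall>u\<in>{u. map snd u = w} - {u. map snd u = w \<and> mono u}. (\<Prod>B\<in>\<pi>. mix \<xi> \<eta> (nths u B)) = 0"
    proof
      fix u assume u: "u \<in> {u. map snd u = w} - {u. map snd u = w \<and> mono u}"
      then obtain B where B: "B \<in> \<pi>" "\<not> (\<exists>e. \<forall>p\<in>B. fst (u ! p) = e)" by (auto simp: mono_def)
      then obtain p q where "p \<in> B" "q \<in> B" "fst (u ! p) \<noteq> fst (u ! q)" by blast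
      then show "(\<Prod>B\<in>\<pi>. mix \<xi> \<eta> (nths u B)) = 0"
        using \<pi> B(1) u len[of u] by (intro prod_mix_eq_0[of \<pi> i u B p q]) auto
    qed
  qed (auto simp: finite_labellings)
  also have "\<dots> = (\<Sum>T\<in>Pow \<pi>. (\<Prod>B\<in>T. \<xi> (nths w B)) * (\<Prod>B\<in>\<pi> - T. \<eta> (nths w B)))"
  proof (rule sum.reindex_bij_witness[where i = lab and j = col])
    fix u assume "u \<in> {u. map snd u = w \<and> mono u}"
    then have u: "map snd u = w" "mono u" by auto
    note ul = len[OF u(1)]
    have Y: "fst (u ! p) = Y" if B: "B \<in> \<pi>" "B \<notin> col u" "p \<in> B" for B p
    proof -
      obtain e where e: "\<forall>p\<in>B. fst (u ! p) = e" using u(2) B(1) unfolding mono_def by blast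
      then have "e \<noteq> X" using B by (auto simp: col_def)
      then show ?thesis using e B(3) by (cases e) auto
    qed
    show "lab (col u) = u"
    proof (rule nth_equalityI)
      show "length (lab (col u)) = length u" by (simp add: lab_def ul)
      fix p assume "p < length (lab (col u))"
      then have p: "p < length w" by (simp add: lab_def)
      then obtain B where B: "B \<in> \<pi>" "p \<in> B" using parts_Union[OF \<pi>] by blast
      have "fst (lab (col u) ! p) = fst (u ! p)"
        using fst_lab[of "col u" B p] Y[of B p] B by (auto simp: col_def)
      moreover have "snd (lab (col u) ! p) = snd (u ! p)"
        using lab_nth[OF p] nth_map[of p u snd] p ul by (simp add: u(1))
      ultimately show "lab (col u) ! p = u ! p" by (rule prod_eqI)
    qed
    show "col u \<in> Pow \<pi>" by (auto simp: col_def)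
    have snd: "map snd (nths u B) = nths w B" for B by (simp add: u(1) flip: nths_map)
    have "mix \<xi> \<eta> (nths u B) = \<xi> (nths w B)" if "B \<in> col u" for B
    proof -
      have "\<forall>p\<in>B. fst (u ! p) = X" using that by (simp add: col_def)
      then have "\<forall>z\<in>set (nths u B). fst z = X" unfolding set_nths by force
      then show ?thesis unfolding mix_def snd by (rule if_P)
    qed
    moreover have "mix \<xi> \<eta> (nths u B) = \<eta> (nths w B)" if B: "B \<in> \<pi> - col u" for B
    proof -
      \<comment> \<open>\<open>mix\<close> tests for x before y, so a letter labelled y has to be
        exhibited; a nonempty block provides it.\<close>
      obtain p where "p \<in> B" using parts_block_nonempty[OF \<pi>] B by blast
      then have "u ! p \<in> set (nths u B)" using sub[of B] B ul by (auto simp: set_nths)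
      moreover have "\<forall>z\<in>set (nths u B). fst z = Y" using Y B unfolding set_nths by force
      moreover have "fst (u ! p) \<noteq> X" using calculation by simp
      ultimately have "\<not> (\<forall>z\<in>set (nths u B). fst z = X)" "\<forall>z\<in>set (nths u B). fst z = Y"
        by blast+
      then show ?thesis unfolding mix_def snd by (rule trans[OF if_not_P if_P])
    qed
    ultimately show "(\<Prod>B\<in>col u. \<xi> (nths w B)) * (\<Prod>B\<in>\<pi> - col u. \<eta> (nths w B))
        = (\<Prod>B\<in>\<pi>. mix \<xi> \<eta> (nths u B))"
      using fin by (simp add: prod.subset_diff[of "col u" \<pi>] col_def mult.commute)
  next
    fix T assume "T \<in> Pow \<pi>"
    then have T: "T \<subseteq> \<pi>" by simp
    show "col (lab T) = T"
    proof (intro equalityI subsetI)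
      fix B assume "B \<in> col (lab T)"
      then have B: "B \<in> \<pi>" "\<forall>p\<in>B. fst (lab T ! p) = X" by (auto simp: col_def)
      moreover obtain p where "p \<in> B" using parts_block_nonempty[OF \<pi> B(1)] by blast
      ultimately show "B \<in> T" using fst_lab[OF T B(1), of p] by (auto split: if_splits)
    next
      fix B assume "B \<in> T"
      then show "B \<in> col (lab T)" using fst_lab[OF T, of B] T by (auto simp: col_def)
    qed
    have "map snd (lab T) = w" by (simp add: lab_def comp_def map_nth)
    moreover have "mono (lab T)" using fst_lab[OF T] unfolding mono_def by blast
    ultimately show "lab T \<in> {u. map snd u = w \<and> mono u}" by simp
  qed
  also have "\<dots> = (\<Prod>B\<in>\<pi>. \<xi> (nths w B) + \<eta> (nths w B))"
    by (rule prod_add[OF fin, symmetric])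
  finally show ?thesis .
qed

text \<open>The admissible partitions depend only on the length, which all labellings share, so the
  two sums can be exchanged.\<close>

lemma sum_labellings_mom_mix:
  "(\<Sum>u | map snd u = w. mom i (mix \<xi> \<eta>) u) = mom i (\<lambda>v. \<xi> v + \<eta> v) w"
proof -
  have "(\<Sum>u | map snd u = w. mom i (mix \<xi> \<eta>) u)
      = (\<Sum>u | map snd u = w. \<Sum>\<pi>\<in>parts i {..<length w}. \<Prod>B\<in>\<pi>. mix \<xi> \<eta> (nths u B))"
    by (rule sum.cong) (auto simp: mom_def)
  also have "\<dots> = (\<Sum>\<pi>\<in>parts i {..<length w}. \<Sum>u | map snd u = w. \<Prod>B\<in>\<pi>. mix \<xi> \<eta> (nths u B))"
    by (rule sum.swap)
  finally show ?thesis by (simp add: sum_labellings_prod_mix mom_def)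
qed

section \<open>Moment and cumulant maps on truncated families\<close>

definition moments :: "independence \<Rightarrow> nat \<Rightarrow> nat \<Rightarrow> (nat list \<Rightarrow> 'k) \<Rightarrow> nat list \<Rightarrow> 'k::comm_ring_1" where
  "moments i s n \<xi> = (\<lambda>w. if w \<in> words s n then mom i \<xi> w else 0)"

definition cumulants :: "independence \<Rightarrow> nat \<Rightarrow> nat \<Rightarrow> (nat list \<Rightarrow> 'k) \<Rightarrow> nat list \<Rightarrow> 'k::comm_ring_1" where
  "cumulants i s n f = (\<lambda>w. if w \<in> words s n then cum i f w else 0)"

lemma moments_coords [simp]: "moments i s n \<xi> \<in> coords (words s n)"
  by (simp add: moments_def coords_def)

lemma cumulants_coords [simp]: "cumulants i s n f \<in> coords (words s n)"
  by (simp add: cumulants_def coords_def)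

lemma words_nonempty: "w \<in> words s n \<Longrightarrow> w \<noteq> []"
  by (auto simp: words_def)

text \<open>The closure property that makes truncation consistent: the recursions for a word in
  \<open>words s n\<close> stay inside this set.\<close>

lemma words_sub:
  "w \<in> words s n \<Longrightarrow> v \<noteq> [] \<Longrightarrow> set v \<subseteq> set w \<Longrightarrow> length v \<le> length w \<Longrightarrow> v \<in> words s n"
  by (cases v) (auto simp: words_def)

lemma words_nths:
  assumes "w \<in> words s n" and "nths w B \<noteq> []"
  shows "nths w B \<in> words s n"
proof -
  have "length (nths w B) \<le> card {..<length w}"
    unfolding length_nths by (rule card_mono) auto
  then show ?thesis using assms by (intro words_sub[OF assms]) (auto simp: set_nths_subset)
qed

lemma finite_words: "finite (words s n)"
  by (rule finite_subset[OF _ finite_lists_length_le[of "{1..s}" n]]) (auto simp: words_def)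

lemma mom_cong_words:
  assumes "w \<in> words s n" and "\<And>v. v \<in> words s n \<Longrightarrow> \<kappa> v = \<kappa>' v"
  shows "mom i \<kappa> w = mom i \<kappa>' w"
  by (rule mom_cong) (use assms words_nths in blast)

lemma cum_moments: "w \<in> words s n \<Longrightarrow> cum i (moments i s n \<xi>) w = \<xi> w"
  by (rule cum_mom) (auto simp: moments_def words_nonempty intro: words_sub)

lemma cumulants_moments: "\<xi> \<in> coords (words s n) \<Longrightarrow> cumulants i s n (moments i s n \<xi>) = \<xi>"
  by (rule ext) (auto simp: cumulants_def cum_moments coords_def)

lemma moments_cumulants:
  assumes "f \<in> coords (words s n)"
  shows "moments i s n (cumulants i s n f) = f"
proof
  fix w
  show "moments i s n (cumulants i s n f) w = f w"
  proof (cases "w \<in> words s n")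
    case True
    then have "mom i (cumulants i s n f) w = mom i (cum i f) w"
      by (intro mom_cong_words[OF True]) (simp add: cumulants_def)
    then show ?thesis using True by (simp add: moments_def mom_cum words_nonempty)
  qed (use assms in \<open>simp add: moments_def coords_def\<close>)
qed

lemma add_conv_moments:
  "add_conv i s n (moments i s n \<xi>) (moments i s n \<eta>) = moments i s n (plus_law \<xi> \<eta>)"
proof
  fix w
  show "add_conv i s n (moments i s n \<xi>) (moments i s n \<eta>) w = moments i s n (plus_law \<xi> \<eta>) w"
  proof (cases "w \<in> words s n")
    case True
    have "indep_product i (moments i s n \<xi>) (moments i s n \<eta>) u = mom i (mix \<xi> \<eta>) u" if "map snd u = w" for u
    \<comment> \<open>Truncated moments are moments on nonempty words over \<open>{1..s}\<close> of
      length at most \<open>n\<close>, and a labelled copy \<open>u\<close> of \<open>w\<close>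
      keeps letters and length.\<close>
    proof (rule indep_product_mom[where L = "{1..s}" and n = n])
      have eq: "moments i s n \<zeta> v = mom i \<zeta> v" if "v \<noteq> []" "set v \<subseteq> {1..s}" "length v \<le> n"
        for \<zeta> :: "nat list \<Rightarrow> 'a" and v
        using that by (cases v) (auto simp: moments_def words_def)
      show "moments i s n \<xi> v = mom i \<xi> v" "moments i s n \<eta> v = mom i \<eta> v"
        if "v \<noteq> []" "set v \<subseteq> {1..s}" "length v \<le> n" for v
        using that by (rule eq)+
      show "set (map snd u) \<subseteq> {1..s}" "length u \<le> n"
        using True that by (auto simp: words_def)
    qed
    then show ?thesis
      using True by (simp add: add_conv_def nc_functional_prod_list moments_def plus_law_def
          flip: sum_labellings_mom_mix)
  qed (simp add: add_conv_def moments_def)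
qed

lemma add_conv_cumulants:
  assumes "f \<in> coords (words s n)" and "g \<in> coords (words s n)"
  shows "add_conv i s n f g = moments i s n (plus_law (cumulants i s n f) (cumulants i s n g))"
  using add_conv_moments[of i s n "cumulants i s n f" "cumulants i s n g"] by (simp add: moments_cumulants assms)

section \<open>Group structure transported from addition\<close>

lemma comm_group_additive: "comm_group (additive_group s n :: (nat list \<Rightarrow> 'k::comm_ring_1) monoid)"
proof (rule comm_groupI)
  fix x assume "x \<in> carrier (additive_group s n :: (nat list \<Rightarrow> 'k) monoid)"
  then show "\<exists>y\<in>carrier (additive_group s n). y \<otimes>\<^bsub>additive_group s n\<^esub> x = \<one>\<^bsub>additive_group s n\<^esub>"
    by (intro bexI[of _ "\<lambda>w. - x w"]) (auto simp: additive_group_def law_monoid_def plus_law_def coords_def)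
qed (auto simp: additive_group_def law_monoid_def plus_law_def coords_def ac_simps)

lemma moments_iso: "moments i s n \<in> iso (additive_group s n) (conv_group i s n)"
proof (rule isoI)
  show "moments i s n \<in> hom (additive_group s n) (conv_group i s n)"
    by (auto simp: hom_def additive_group_def conv_group_def law_monoid_def add_conv_moments)
  show "bij_betw (moments i s n) (carrier (additive_group s n)) (carrier (conv_group i s n))"
    by (rule bij_betw_byWitness[where f' = "cumulants i s n"])
      (auto simp: additive_group_def conv_group_def law_monoid_def moments_cumulants cumulants_moments)
qed

lemma mom_zero: "w \<noteq> [] \<Longrightarrow> mom i (\<lambda>_. 0) w = 0"
proof -
  assume "w \<noteq> []"
  have "(\<Prod>B\<in>\<pi>. 0 :: 'b) = 0" if \<pi>: "\<pi> \<in> parts i {..<length w}" for \<pi>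
  proof -
    have "\<pi> \<noteq> {}" using parts_Union[OF \<pi>] \<open>w \<noteq> []\<close> by auto
    then show ?thesis using parts_finite[OF \<pi>] by (auto simp: power_0_left)
  qed
  then show ?thesis by (simp add: mom_def)
qed

lemma moments_zero: "moments i s n (\<lambda>_. 0) = (\<lambda>_. 0)"
  by (auto simp: moments_def mom_zero words_nonempty)

text \<open>The axioms are transported along \<open>moments\<close>. The image structure has the
  image of 0 as its unit, and \<open>moments_zero\<close> identifies it with the prescribed
  one.\<close>

lemma comm_group_conv: "comm_group (conv_group i s n :: (nat list \<Rightarrow> 'k::comm_ring_1) monoid)"
proof -
  interpret A: comm_group "additive_group s n :: (nat list \<Rightarrow> 'k) monoid"
    by (rule comm_group_additive)
  have "comm_group (conv_group i s n
      \<lparr>one := moments i s n \<one>\<^bsub>additive_group s n :: (nat list \<Rightarrow> 'k) monoid\<^esub>\<rparr>)"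
    by (rule A.iso_imp_img_comm_group[OF moments_iso])
  then show ?thesis
    by (simp add: additive_group_def conv_group_def law_monoid_def moments_zero)
qed

text \<open>The blocks use every position once. All homogeneity statements rest on this: a product
  over blocks has total degree \<open>length w\<close>.\<close>

lemma sum_length_blocks:
  assumes "\<pi> \<in> parts i {..<length w}"
  shows "(\<Sum>B\<in>\<pi>. length (nths w B)) = length w"
proof -
  have "(\<Sum>B\<in>\<pi>. length (nths w B)) = (\<Sum>B\<in>\<pi>. card B)"
    by (intro sum.cong) (simp_all add: nths_block[OF assms])
  also have "\<dots> = card {..<length w}"
    using assms parts_block[OF assms] finite_subset
    by (intro product_partition[symmetric]) (auto simp: parts_def)
  finally show ?thesis by simp
qed

lemma mom_dilation: "mom i (dilation length c \<kappa>) w = c ^ length w * mom i \<kappa> w"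
proof -
  have "(\<Prod>B\<in>\<pi>. dilation length c \<kappa> (nths w B)) = c ^ length w * (\<Prod>B\<in>\<pi>. \<kappa> (nths w B))"
    if "\<pi> \<in> parts i {..<length w}" for \<pi>
    using sum_length_blocks[OF that] by (simp add: dilation_def prod.distrib flip: power_sum)
  then show ?thesis by (simp add: mom_def sum_distrib_left)
qed

lemma moments_dilation: "moments i s n (dilation length c \<xi>) = dilation length c (moments i s n \<xi>)"
proof
  fix w
  have "dilation length c (moments i s n \<xi>) w = c ^ length w * moments i s n \<xi> w"
    by (simp add: dilation_def)
  then show "moments i s n (dilation length c \<xi>) w = dilation length c (moments i s n \<xi>) w"
    by (simp add: moments_def mom_dilation)
qed

lemma homogeneous_conv: "homogeneous_group length (conv_group i s n :: (nat list \<Rightarrow> 'k::field) monoid)"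
  unfolding homogeneous_group_def
proof (intro allI impI isoI)
  fix c :: 'k assume c: "c \<noteq> 0"
  have dil: "dilation length d f \<in> coords (words s n)" if "f \<in> coords (words s n)" for d and f :: "nat list \<Rightarrow> 'k"
    using that by (simp add: coords_def dilation_def)
  have "dilation length c (add_conv i s n f g) = add_conv i s n (dilation length c f) (dilation length c g)"
    if fg: "f \<in> coords (words s n)" "g \<in> coords (words s n)" for f g
  proof -
    obtain \<xi> \<eta> where "f = moments i s n \<xi>" "g = moments i s n \<eta>"
      using moments_cumulants[OF fg(1)] moments_cumulants[OF fg(2)] by metis
    moreover have "dilation length c (plus_law \<xi> \<eta>) = plus_law (dilation length c \<xi>) (dilation length c \<eta>)"
      by (simp add: dilation_def plus_law_def distrib_left)
    ultimately show ?thesis by (simp add: add_conv_moments flip: moments_dilation)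
  qed
  then show "dilation length c \<in> hom (conv_group i s n) (conv_group i s n)"
    using dil by (auto simp: hom_def conv_group_def law_monoid_def)
  show "bij_betw (dilation length c) (carrier (conv_group i s n)) (carrier (conv_group i s n))"
    using c dil by (intro bij_betw_byWitness[where f' = "dilation length (inverse c)"])
      (auto simp: conv_group_def law_monoid_def, auto simp: dilation_def power_inverse)
qed


section \<open>Homogeneous polynomial functions\<close>

text \<open>The map \<open>e\<close> turns an argument into a valuation of the variables. One
  calculus then covers functions of a single family and, with \<open>case_sum\<close>, functions of
  a pair.\<close>

definition hpoly :: "('a \<Rightarrow> 'v \<Rightarrow> 'k) \<Rightarrow> 'v set \<Rightarrow> ('v \<Rightarrow> nat) \<Rightarrow> nat \<Rightarrow> ('a \<Rightarrow> 'k::comm_ring_1) \<Rightarrow> bool" where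
  "hpoly e V \<sigma> d h \<longleftrightarrow> (\<exists>P. mpoly_vars P \<subseteq> V \<and> mpoly_homogeneous \<sigma> d P \<and> (\<forall>a. h a = mpoly_eval (e a) P))"

lemma hpolyI:
  "mpoly_vars P \<subseteq> V \<Longrightarrow> mpoly_homogeneous \<sigma> d P \<Longrightarrow> (\<And>a. h a = mpoly_eval (e a) P) \<Longrightarrow> hpoly e V \<sigma> d h"
  by (auto simp: hpoly_def)

lemma mpoly_eval_single [simp]:
  "mpoly_eval x (Poly_Mapping.single m c) = c * (\<Prod>v\<in>Poly_Mapping.keys m. x v ^ Poly_Mapping.lookup m v)"
  by (simp add: mpoly_eval_def)

lemma mpoly_eval_add: "mpoly_eval x (P + Q) = mpoly_eval x P + mpoly_eval x Q"
  unfolding mpoly_eval_def by (rule setsum_keys_plus_distrib) (simp_all add: algebra_simps)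

text \<open>All three products are extended to the union of the two supports, where the additional
  factors have exponent 0.\<close>

lemma monomial_eval_add:
  fixes x :: "'v \<Rightarrow> 'k::comm_semiring_1" and m m' :: "'v \<Rightarrow>\<^sub>0 nat"
  shows "(\<Prod>v\<in>Poly_Mapping.keys (m + m'). x v ^ Poly_Mapping.lookup (m + m') v)
    = (\<Prod>v\<in>Poly_Mapping.keys m. x v ^ Poly_Mapping.lookup m v)
    * (\<Prod>v\<in>Poly_Mapping.keys m'. x v ^ Poly_Mapping.lookup m' v)"
proof -
  have "(\<Prod>v\<in>Poly_Mapping.keys p. x v ^ Poly_Mapping.lookup p v)
      = (\<Prod>v\<in>Poly_Mapping.keys m \<union> Poly_Mapping.keys m'. x v ^ Poly_Mapping.lookup p v)"
    if "Poly_Mapping.keys p \<subseteq> Poly_Mapping.keys m \<union> Poly_Mapping.keys m'" for p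
    by (rule prod.mono_neutral_left) (use that in \<open>auto simp: in_keys_iff\<close>)
  from this[of "m + m'"] this[of m] this[of m'] show ?thesis
    using keys_add[of m m'] by (simp add: lookup_add power_add prod.distrib)
qed

lemma mpoly_eval_mult: "mpoly_eval x (P * Q) = mpoly_eval x P * mpoly_eval x Q"
proof (induction P rule: poly_mapping_single_add_induct)
  case (single m c)
  show ?case
  proof (induction Q rule: poly_mapping_single_add_induct)
    case (single m' c')
    then show ?case by (simp add: mult_single monomial_eval_add mult_ac)
  qed (simp add: distrib_left mpoly_eval_add)
qed (simp add: distrib_right mpoly_eval_add)

lemma hpoly_var: "v \<in> V \<Longrightarrow> hpoly e V \<sigma> (\<sigma> v) (\<lambda>a. e a v)"
  by (rule hpolyI[where P = "Poly_Mapping.single (Poly_Mapping.single v 1) 1"])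
    (auto simp: mpoly_vars_def mpoly_homogeneous_def split: if_splits)

lemma hpoly_const: "hpoly e V \<sigma> 0 (\<lambda>a. c)"
  by (rule hpolyI[where P = "Poly_Mapping.single 0 c"])
    (auto simp: mpoly_vars_def mpoly_homogeneous_def split: if_splits)

lemma hpoly_0: "hpoly e V \<sigma> d (\<lambda>a. 0)"
  by (rule hpolyI[where P = 0]) (auto simp: mpoly_vars_def mpoly_homogeneous_def mpoly_eval_def)

lemma hpoly_add:
  assumes "hpoly e V \<sigma> d h" "hpoly e V \<sigma> d h'"
  shows "hpoly e V \<sigma> d (\<lambda>a. h a + h' a)"
proof -
  obtain P Q where P: "mpoly_vars P \<subseteq> V" "mpoly_homogeneous \<sigma> d P" "\<And>a. h a = mpoly_eval (e a) P"
    and Q: "mpoly_vars Q \<subseteq> V" "mpoly_homogeneous \<sigma> d Q" "\<And>a. h' a = mpoly_eval (e a) Q"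
    using assms by (auto simp: hpoly_def)
  show ?thesis
  proof (rule hpolyI[where P = "P + Q"])
    have keys: "m \<in> Poly_Mapping.keys P \<or> m \<in> Poly_Mapping.keys Q" if "m \<in> Poly_Mapping.keys (P + Q)" for m
      using keys_add[of P Q] that by blast
    show "mpoly_vars (P + Q) \<subseteq> V"
      using P(1) Q(1) by (auto simp: mpoly_vars_def dest!: keys)
    show "mpoly_homogeneous \<sigma> d (P + Q)"
      using P(2) Q(2) by (auto simp: mpoly_homogeneous_def dest!: keys)
  qed (simp add: P Q mpoly_eval_add)
qed

lemma hpoly_mult:
  assumes "hpoly e V \<sigma> d h" "hpoly e V \<sigma> d' h'"
  shows "hpoly e V \<sigma> (d + d') (\<lambda>a. h a * h' a)"
proof -
  obtain P Q where P: "mpoly_vars P \<subseteq> V" "mpoly_homogeneous \<sigma> d P" "\<And>a. h a = mpoly_eval (e a) P"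
    and Q: "mpoly_vars Q \<subseteq> V" "mpoly_homogeneous \<sigma> d' Q" "\<And>a. h' a = mpoly_eval (e a) Q"
    using assms by (auto simp: hpoly_def)
  have keys: "\<exists>p\<in>Poly_Mapping.keys P. \<exists>q\<in>Poly_Mapping.keys Q. m = p + q" if "m \<in> Poly_Mapping.keys (P * Q)" for m
    using subsetD[OF keys_mult that] by blast
  show ?thesis
  proof (rule hpolyI[where P = "P * Q"])
    show "mpoly_vars (P * Q) \<subseteq> V"
      unfolding mpoly_vars_def
    proof (rule UN_least)
      fix m assume "m \<in> Poly_Mapping.keys (P * Q)"
      then obtain p q where "p \<in> Poly_Mapping.keys P" "q \<in> Poly_Mapping.keys Q" "m = p + q"
        using keys by blast
      then show "Poly_Mapping.keys m \<subseteq> V"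
        using P(1) Q(1) keys_add[of p q] unfolding mpoly_vars_def by blast
    qed
    show "mpoly_homogeneous \<sigma> (d + d') (P * Q)"
      unfolding mpoly_homogeneous_def
    proof
      fix m assume "m \<in> Poly_Mapping.keys (P * Q)"
      then obtain p q where pq: "p \<in> Poly_Mapping.keys P" "q \<in> Poly_Mapping.keys Q" "m = p + q"
        using keys by blast
      have "(\<Sum>v\<in>Poly_Mapping.keys (p + q). Poly_Mapping.lookup (p + q) v * \<sigma> v)
          = (\<Sum>v\<in>Poly_Mapping.keys p. Poly_Mapping.lookup p v * \<sigma> v)
          + (\<Sum>v\<in>Poly_Mapping.keys q. Poly_Mapping.lookup q v * \<sigma> v)"
        by (rule setsum_keys_plus_distrib) (simp_all add: algebra_simps)
      then show "(\<Sum>v\<in>Poly_Mapping.keys m. Poly_Mapping.lookup m v * \<sigma> v) = d + d'"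
        using P(2) Q(2) pq by (simp add: mpoly_homogeneous_def)
    qed
  qed (simp add: P Q mpoly_eval_mult)
qed

lemma hpoly_diff:
  assumes "hpoly e V \<sigma> d h" "hpoly e V \<sigma> d h'"
  shows "hpoly e V \<sigma> d (\<lambda>a. h a - h' a)"
proof -
  have "hpoly e V \<sigma> d (\<lambda>a. - 1 * h' a)"
    using hpoly_mult[OF hpoly_const[of e V \<sigma> "- 1"] assms(2)] by simp
  from hpoly_add[OF assms(1) this] show ?thesis by simp
qed

lemma hpoly_sum:
  "(\<And>x. x \<in> S \<Longrightarrow> hpoly e V \<sigma> d (h x)) \<Longrightarrow> hpoly e V \<sigma> d (\<lambda>a. \<Sum>x\<in>S. h x a)"
  by (induction S rule: infinite_finite_induct) (simp_all add: hpoly_0 hpoly_add)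

lemma hpoly_prod:
  "(\<And>x. x \<in> S \<Longrightarrow> hpoly e V \<sigma> (d x) (h x)) \<Longrightarrow> hpoly e V \<sigma> (\<Sum>x\<in>S. d x) (\<lambda>a. \<Prod>x\<in>S. h x a)"
  by (induction S rule: infinite_finite_induct) (simp_all add: hpoly_const hpoly_mult)

lemma hpoly_prod_blocks:
  assumes "\<pi> \<in> parts i {..<length w}"
    and "\<And>B. B \<in> \<pi> \<Longrightarrow> hpoly e V \<sigma> (length (nths w B)) (\<lambda>a. F a (nths w B))"
  shows "hpoly e V \<sigma> (length w) (\<lambda>a. \<Prod>B\<in>\<pi>. F a (nths w B))"
  using hpoly_prod[of \<pi> e V \<sigma> "\<lambda>B. length (nths w B)" "\<lambda>B a. F a (nths w B)"] assms
  by (simp add: sum_length_blocks)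

lemma hpoly_mom:
  assumes "w \<in> words s n" and "\<And>v. v \<in> words s n \<Longrightarrow> hpoly e V \<sigma> (length v) (\<lambda>a. F a v)"
  shows "hpoly e V \<sigma> (length w) (\<lambda>a. mom i (F a) w)"
  unfolding mom_def
  by (intro hpoly_sum hpoly_prod_blocks assms(2) words_nths[OF assms(1)]) (auto dest: nths_block)

lemma hpoly_cum:
  assumes "w \<in> words s n" and "\<And>v. v \<in> words s n \<Longrightarrow> hpoly e V \<sigma> (length v) (\<lambda>a. F a v)"
  shows "hpoly e V \<sigma> (length w) (\<lambda>a. cum i (F a) w)"
  using assms(1)
proof (induction "length w" arbitrary: w rule: less_induct)
  case less
  have "hpoly e V \<sigma> (length w) (\<lambda>a. F a w
      - (\<Sum>\<pi>\<in>parts i {..<length w} - {{{..<length w}}}. \<Prod>B\<in>\<pi>. cum i (F a) (nths w B)))"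
  proof (intro hpoly_diff hpoly_sum hpoly_prod_blocks less.hyps)
    fix \<pi> B assume \<pi>: "\<pi> \<in> parts i {..<length w} - {{{..<length w}}}" and B: "B \<in> \<pi>"
    show "length (nths w B) < length w" by (rule length_nths_proper_block[OF \<pi> B])
    show "nths w B \<in> words s n"
      using \<pi> B less.prems by (intro words_nths nths_block(1)) auto
  qed (use assms(2) less.prems in auto)
  then show ?case by (subst cum.simps) simp
qed

text \<open>The law is read in cumulant coordinates, as a moment of a sum of cumulants. That
  expression is polynomial in arbitrary arguments, as \<open>hpoly\<close> demands, and agrees with
  the law on \<open>coords\<close>.\<close>

lemma polynomial_law_conv:
  "polynomial_law (words s n) (add_conv i s n :: (nat list \<Rightarrow> 'k::comm_ring_1) \<Rightarrow> _)"
  unfolding polynomial_law_def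
proof
  fix w assume w: "w \<in> words s n"
  define W where "W = words s n"
  define e :: "(nat list \<Rightarrow> 'k) \<times> (nat list \<Rightarrow> 'k) \<Rightarrow> nat list + nat list \<Rightarrow> 'k"
    where "e a = case_sum (fst a) (snd a)" for a
  define V where "V = Inl ` W \<union> Inr ` W"
  define \<sigma> where "\<sigma> = case_sum (length :: nat list \<Rightarrow> nat) (length :: nat list \<Rightarrow> nat)"
  have "hpoly e V \<sigma> (length v) (\<lambda>a. fst a v)" "hpoly e V \<sigma> (length v) (\<lambda>a. snd a v)"
    if "v \<in> words s n" for v
    using hpoly_var[of "Inl v" V e \<sigma>] hpoly_var[of "Inr v" V e \<sigma>] that
    by (auto simp: e_def V_def W_def \<sigma>_def)
  then have "hpoly e V \<sigma> (length w) (\<lambda>a. mom i (\<lambda>v. cum i (fst a) v + cum i (snd a) v) w)"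
    by (intro hpoly_mom[OF w] hpoly_add hpoly_cum)
  then obtain P where P: "mpoly_vars P \<subseteq> V"
    "\<And>a. mom i (\<lambda>v. cum i (fst a) v + cum i (snd a) v) w = mpoly_eval (e a) P"
    by (auto simp: hpoly_def)
  have "add_conv i s n x y w = mpoly_eval (case_sum x y) P" if "x \<in> coords W" "y \<in> coords W" for x y
  proof -
    have "add_conv i s n x y w = mom i (plus_law (cumulants i s n x) (cumulants i s n y)) w"
      using that w by (simp add: add_conv_cumulants W_def moments_def)
    also have "\<dots> = mom i (\<lambda>v. cum i x v + cum i y v) w"
      by (rule mom_cong_words[OF w]) (simp add: plus_law_def cumulants_def)
    also have "\<dots> = mpoly_eval (case_sum x y) P" using P(2)[of "(x, y)"] by (simp add: e_def)
    finally show ?thesis .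
  qed
  then show "\<exists>P. mpoly_vars P \<subseteq> Inl ` words s n \<union> Inr ` words s n \<and>
      (\<forall>x\<in>coords (words s n). \<forall>y\<in>coords (words s n). (add_conv i s n x y w :: 'k) = mpoly_eval (case_sum x y) P)"
    using P(1) unfolding V_def W_def by (intro exI[of _ P]) simp
qed

lemma homogeneous_polynomial_map_moments_cumulants:
  "homogeneous_polynomial_map (words s n) length (moments j s n \<circ> cumulants i s n)"
  unfolding homogeneous_polynomial_map_def
proof
  fix w assume w: "w \<in> words s n"
  have "hpoly (\<lambda>a. a) (words s n) length (length w) (\<lambda>a. mom j (cum i a) w)"
    by (intro hpoly_mom[OF w] hpoly_cum hpoly_var)
  moreover have "(moments j s n \<circ> cumulants i s n) x w = mom j (cum i x) w" for x
    using w mom_cong_words[OF w, of "cumulants i s n x" "cum i x"] by (simp add: moments_def cumulants_def)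
  ultimately show "\<exists>P. mpoly_vars P \<subseteq> words s n \<and> mpoly_homogeneous length (length w) P \<and>
      (\<forall>x\<in>coords (words s n). (moments j s n \<circ> cumulants i s n) x w = mpoly_eval x P)"
    unfolding hpoly_def by metis
qed

section \<open>EXP and LOG in cumulant coordinates\<close>

text \<open>The derivative of \<open>mom i\<close> at \<open>\<kappa>\<close> in the direction
  \<open>\<xi>\<close>, written out by the product rule.\<close>

definition mom_deriv :: "independence \<Rightarrow> ('a list \<Rightarrow> 'k) \<Rightarrow> ('a list \<Rightarrow> 'k) \<Rightarrow> 'a list \<Rightarrow> 'k::comm_ring_1" where
  "mom_deriv i \<kappa> \<xi> w = (\<Sum>\<pi>\<in>parts i {..<length w}. \<Sum>B\<in>\<pi>. (\<Prod>C\<in>\<pi> - {B}. \<kappa> (nths w C)) * \<xi> (nths w B))"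

lemma mom_deriv_cong:
  assumes "\<And>B. nths w B \<noteq> [] \<Longrightarrow> \<kappa> (nths w B) = \<kappa>' (nths w B)"
    and "\<And>B. nths w B \<noteq> [] \<Longrightarrow> \<xi> (nths w B) = \<xi>' (nths w B)"
  shows "mom_deriv i \<kappa> \<xi> w = mom_deriv i \<kappa>' \<xi>' w"
  unfolding mom_deriv_def
  by (intro sum.cong prod.cong arg_cong2[where f = "(*)"] refl assms) (auto dest: nths_block)

lemma mom_deriv_cong_words:
  assumes "w \<in> words s n" and "\<And>v. v \<in> words s n \<Longrightarrow> \<kappa> v = \<kappa>' v"
    and "\<And>v. v \<in> words s n \<Longrightarrow> \<xi> v = \<xi>' v"
  shows "mom_deriv i \<kappa> \<xi> w = mom_deriv i \<kappa>' \<xi>' w"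
  by (rule mom_deriv_cong) (use assms words_nths in blast)+

lemma mom_deriv_top:
  assumes "w \<noteq> []"
  shows "mom_deriv i \<kappa> \<xi> w = \<xi> w + (\<Sum>\<pi>\<in>parts i {..<length w} - {{{..<length w}}}.
    \<Sum>B\<in>\<pi>. (\<Prod>C\<in>\<pi> - {B}. \<kappa> (nths w C)) * \<xi> (nths w B))"
proof -
  have "{{..<length w}} \<in> parts i {..<length w}" using assms by (intro top_in_parts) auto
  moreover have "nths w {..<length w} = w" by (simp add: nths_all)
  ultimately show ?thesis
    by (simp add: mom_deriv_def sum.remove[of _ "{{..<length w}}"] finite_parts)
qed

text \<open>Any partition with more than one block keeps a factor \<open>\<kappa>\<close> on another
  block, and this factor is 0.\<close>

lemma mom_deriv_zero:
  assumes "w \<noteq> []"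
  shows "mom_deriv i (\<lambda>_. 0) \<xi> w = \<xi> w"
proof -
  have "(\<Prod>C\<in>\<pi> - {B}. 0 :: 'b) * \<xi> (nths w B) = 0"
    if \<pi>: "\<pi> \<in> parts i {..<length w} - {{{..<length w}}}" and B: "B \<in> \<pi>" for \<pi> B
  proof -
    have \<pi>': "\<pi> \<in> parts i {..<length w}" using \<pi> by simp
    have "\<pi> \<noteq> {B}"
    proof
      assume "\<pi> = {B}"
      then have "\<pi> = {{..<length w}}" using parts_Union[OF \<pi>'] by simp
      then show False using \<pi> by simp
    qed
    then have "\<pi> - {B} \<noteq> {}" using B by blast
    then have "card (\<pi> - {B}) \<noteq> 0" using parts_finite[OF \<pi>'] by simp
    then show ?thesis by (simp add: power_0_left)
  qed
  then show ?thesis by (simp add: mom_deriv_top[OF assms])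
qed

text \<open>For fixed \<open>\<kappa>\<close> the map is unitriangular with respect to word length.
  In the equation of a curve it allows the differential of the moment map to be cancelled.\<close>

lemma mom_deriv_inject:
  assumes "\<And>v. v \<in> words s n \<Longrightarrow> mom_deriv i \<kappa> \<xi> v = mom_deriv i \<kappa> \<eta> v" and "w \<in> words s n"
  shows "\<xi> w = \<eta> w"
  using assms(2)
proof (induction "length w" arbitrary: w rule: less_induct)
  case less
  have "(\<Prod>C\<in>\<pi> - {B}. \<kappa> (nths w C)) * \<xi> (nths w B) = (\<Prod>C\<in>\<pi> - {B}. \<kappa> (nths w C)) * \<eta> (nths w B)"
    if "\<pi> \<in> parts i {..<length w} - {{{..<length w}}}" "B \<in> \<pi>" for \<pi> B
  proof -
    have "nths w B \<in> words s n" using that nths_block(1) by (intro words_nths less.prems) auto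
    then show ?thesis using less.hyps[OF length_nths_proper_block[OF that]] by simp
  qed
  then show ?case
    using assms(1)[OF less.prems] by (simp add: mom_deriv_top words_nonempty[OF less.prems])
qed

lemma mom_deriv_sum: "(\<Sum>u\<in>S. mom_deriv i \<kappa> (\<xi> u) w * c u) = mom_deriv i \<kappa> (\<lambda>v. \<Sum>u\<in>S. \<xi> u v * c u) w"
proof -
  have "(\<Sum>u\<in>S. mom_deriv i \<kappa> (\<xi> u) w * c u) = (\<Sum>u\<in>S. \<Sum>\<pi>\<in>parts i {..<length w}. \<Sum>B\<in>\<pi>.
      (\<Prod>C\<in>\<pi> - {B}. \<kappa> (nths w C)) * (\<xi> u (nths w B) * c u))"
    by (simp add: mom_deriv_def sum_distrib_right mult.assoc)
  also have "\<dots> = (\<Sum>\<pi>\<in>parts i {..<length w}. \<Sum>u\<in>S. \<Sum>B\<in>\<pi>.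
      (\<Prod>C\<in>\<pi> - {B}. \<kappa> (nths w C)) * (\<xi> u (nths w B) * c u))"
    by (rule sum.swap)
  also have "\<dots> = (\<Sum>\<pi>\<in>parts i {..<length w}. \<Sum>B\<in>\<pi>. \<Sum>u\<in>S.
      (\<Prod>C\<in>\<pi> - {B}. \<kappa> (nths w C)) * (\<xi> u (nths w B) * c u))"
    by (intro sum.cong refl sum.swap)
  finally show ?thesis by (simp add: mom_deriv_def sum_distrib_left)
qed

text \<open>Evaluation at \<open>t\<close> is a ring homomorphism from \<open>'k poly\<close>, so it
  passes through sums over partitions and products over blocks.\<close>

lemma poly_mom: "poly (mom i \<Gamma> w) t = mom i (\<lambda>v. poly (\<Gamma> v) t) w"
  by (simp add: mom_def poly_sum poly_prod)

lemma poly_cum: "poly (cum i \<Gamma> w) t = cum i (\<lambda>v. poly (\<Gamma> v) t) w"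
proof (induction "length w" arbitrary: w rule: less_induct)
  case less
  then show ?case
    by (subst (1 2) cum.simps) (simp add: poly_sum poly_prod length_nths_proper_block)
qed

lemma cum_zero: "w \<noteq> [] \<Longrightarrow> cum i (\<lambda>_. 0) w = 0"
  by (rule cum_mom[where \<kappa> = "\<lambda>_. 0"]) (simp_all add: mom_zero)

lemma poly_pderiv_mom:
  "poly (pderiv (mom i \<Gamma> w)) t = mom_deriv i (\<lambda>v. poly (\<Gamma> v) t) (\<lambda>v. poly (pderiv (\<Gamma> v)) t) w"
  by (simp add: mom_def mom_deriv_def higher_pderiv_sum[of 1, simplified] pderiv_prod poly_sum poly_prod)

text \<open>Cumulants have identity linear part: differentiate \<open>mom i (cum i \<Gamma>) = \<Gamma>\<close>.\<close>

lemma poly_pderiv_cum_0: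
  fixes \<Gamma> :: "'a list \<Rightarrow> 'k::idom poly"
  assumes "\<And>v. poly (\<Gamma> v) 0 = 0" and "w \<noteq> []"
  shows "poly (pderiv (cum i \<Gamma> w)) 0 = poly (pderiv (\<Gamma> w)) 0"
proof -
  have "poly (pderiv (\<Gamma> w)) 0 = poly (pderiv (mom i (cum i \<Gamma>) w)) 0"
    by (simp add: mom_cum assms(2))
  also have "\<dots> = mom_deriv i (\<lambda>v. poly (cum i \<Gamma> v) 0) (\<lambda>v. poly (pderiv (cum i \<Gamma> v)) 0) w"
    by (rule poly_pderiv_mom)
  also have "\<dots> = mom_deriv i (\<lambda>_. 0) (\<lambda>v. poly (pderiv (cum i \<Gamma> v)) 0) w"
    by (rule mom_deriv_cong) (simp_all add: poly_cum assms(1) cum_zero)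
  finally show ?thesis by (simp add: mom_deriv_zero assms(2))
qed

section \<open>Partial derivatives and the Jacobian of the convolution\<close>

lemma partial_deriv_poly:
  fixes p :: "'k::field_char_0 poly"
  assumes "\<And>t. poly p t = h (a(u := t))"
  shows "partial_deriv h u a = poly (pderiv p) (a u)"
proof -
  have "(THE q. \<forall>t. poly q t = h (a(u := t))) = p"
  proof (rule the_equality)
    show "q = p" if "\<forall>t. poly q t = h (a(u := t))" for q
      using that assms by (simp add: poly_eq_poly_eq_iff[symmetric] fun_eq_iff)
  qed (use assms in auto)
  then show ?thesis by (simp add: partial_deriv_def)
qed

text \<open>By the chain rule: the law is \<open>mom i\<close> of a sum of cumulants, the cumulants
  of the second argument vanish at 0, and there they have identity linear part. What remains is the
  derivative of \<open>mom i\<close> at the cumulants of \<open>x\<close> along a unit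
  vector.\<close>

lemma jacobian_conv:
  fixes x :: "nat list \<Rightarrow> 'k::field_char_0"
  assumes x: "x \<in> coords (words s n)" and w: "w \<in> words s n" and u: "u \<in> words s n"
  shows "jacobian (add_conv i s n x) (\<lambda>_. 0) w u = mom_deriv i (cum i x) (\<lambda>v. if v = u then 1 else 0) w"
proof -
  \<comment> \<open>The second argument with coordinate \<open>u\<close> set to the indeterminate
    and all others to 0; \<open>p\<close> is then the polynomial that the partial derivative asks
    for.\<close>
  define \<Gamma> :: "nat list \<Rightarrow> 'k poly" where "\<Gamma> v = (if v = u then [:0, 1:] else 0)" for v
  define p where "p = mom i (\<lambda>v. [:cum i x v:] + cum i \<Gamma> v) w"
  have "poly p t = add_conv i s n x ((\<lambda>_. 0)(u := t)) w" for t
  proof -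
    have "(\<lambda>_. 0)(u := t) \<in> coords (words s n)" using u by (simp add: coords_def)
    then have "add_conv i s n x ((\<lambda>_. 0)(u := t)) w
        = mom i (plus_law (cumulants i s n x) (cumulants i s n ((\<lambda>_. 0)(u := t)))) w"
      using x w by (simp add: add_conv_cumulants moments_def)
    also have "\<dots> = mom i (\<lambda>v. cum i x v + cum i ((\<lambda>_. 0)(u := t)) v) w"
      by (rule mom_cong_words[OF w]) (simp add: plus_law_def cumulants_def)
    finally have "add_conv i s n x ((\<lambda>_. 0)(u := t)) w
        = mom i (\<lambda>v. cum i x v + cum i ((\<lambda>_. 0)(u := t)) v) w" .
    moreover have "(\<lambda>v. poly (\<Gamma> v) t) = (\<lambda>_. 0)(u := t)"
      by (auto simp: \<Gamma>_def)
    ultimately show ?thesis by (simp add: p_def poly_mom poly_cum)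
  qed
  then have "jacobian (add_conv i s n x) (\<lambda>_. 0) w u = poly (pderiv p) 0"
    by (simp add: jacobian_def partial_deriv_poly[of p])
  also have "\<dots> = mom_deriv i (\<lambda>v. poly ([:cum i x v:] + cum i \<Gamma> v) 0)
      (\<lambda>v. poly (pderiv ([:cum i x v:] + cum i \<Gamma> v)) 0) w"
    unfolding p_def by (rule poly_pderiv_mom)
  also have "\<dots> = mom_deriv i (cum i x) (\<lambda>v. if v = u then 1 else 0) w"
  proof (rule mom_deriv_cong)
    have \<Gamma>0: "poly (\<Gamma> v) 0 = 0" for v by (simp add: \<Gamma>_def)
    fix B assume B: "nths w B \<noteq> []"
    show "poly ([:cum i x (nths w B):] + cum i \<Gamma> (nths w B)) 0 = cum i x (nths w B)"
      using B by (simp add: poly_cum \<Gamma>0 cum_zero)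
    show "poly (pderiv ([:cum i x (nths w B):] + cum i \<Gamma> (nths w B))) 0
        = (if nths w B = u then 1 else 0)"
      by (simp add: pderiv_add poly_pderiv_cum_0[OF \<Gamma>0 B])
        (simp add: \<Gamma>_def pderiv_pCons)
  qed
  finally show ?thesis .
qed

text \<open>Linearity of \<open>mom_deriv\<close> in its direction combines the columns. The vector
  field that defines EXP is thus the image under the moment map of the constant field
  \<open>\<xi>\<close>.\<close>

lemma sum_jacobian_conv:
  fixes x \<xi> :: "nat list \<Rightarrow> 'k::field_char_0"
  assumes "x \<in> coords (words s n)" and w: "w \<in> words s n"
  shows "(\<Sum>u\<in>words s n. jacobian (add_conv i s n x) (\<lambda>_. 0) w u * \<xi> u) = mom_deriv i (cum i x) \<xi> w"
proof -
  have "(\<Sum>u\<in>words s n. jacobian (add_conv i s n x) (\<lambda>_. 0) w u * \<xi> u)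
      = (\<Sum>u\<in>words s n. mom_deriv i (cum i x) (\<lambda>v. if v = u then 1 else 0) w * \<xi> u)"
    using assms by (simp add: jacobian_conv)
  also have "\<dots> = mom_deriv i (cum i x) (\<lambda>v. \<Sum>u\<in>words s n. (if v = u then 1 else 0) * \<xi> u) w"
    by (rule mom_deriv_sum)
  also have "\<dots> = mom_deriv i (cum i x) \<xi> w"
  proof (rule mom_deriv_cong_words[OF w refl])
    fix v assume "v \<in> words s n"
    then show "(\<Sum>u\<in>words s n. (if v = u then 1 else 0) * \<xi> u) = \<xi> v"
      by (simp add: if_distrib[of "\<lambda>x. x * _"] finite_words cong: if_cong)
  qed
  finally show ?thesis .
qed

text \<open>The moments of the straight line from 0 with direction \<open>\<xi>\<close>, computed in
  the polynomial ring.\<close>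

definition moment_curve :: "independence \<Rightarrow> nat \<Rightarrow> nat \<Rightarrow> (nat list \<Rightarrow> 'k) \<Rightarrow> nat list \<Rightarrow> 'k::comm_ring_1 poly" where
  "moment_curve i s n \<xi> = moments i s n (\<lambda>v. [:0, \<xi> v:])"

lemma poly_moment_curve: "poly (moment_curve i s n \<xi> v) t = moments i s n (\<lambda>v. t * \<xi> v) v"
  by (simp add: moment_curve_def moments_def poly_mom)

lemma exp_curve_moment_curve:
  fixes \<xi> :: "nat list \<Rightarrow> 'k::field_char_0"
  shows "exp_curve (words s n) (add_conv i s n) \<xi> (moment_curve i s n \<xi>)"
  unfolding exp_curve_def
proof (intro conjI ballI allI)
  show "moment_curve i s n \<xi> \<in> coords (words s n)" by (simp add: moment_curve_def)
  show "poly (moment_curve i s n \<xi> w) 0 = 0" for w by (simp add: poly_moment_curve moments_zero)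
  fix t w assume w: "w \<in> words s n"
  have "poly (pderiv (moment_curve i s n \<xi> w)) t = mom_deriv i (\<lambda>v. t * \<xi> v) \<xi> w"
    using w by (simp add: moment_curve_def moments_def poly_pderiv_mom pderiv_pCons)
  also have "\<dots> = mom_deriv i (cum i (moments i s n (\<lambda>v. t * \<xi> v))) \<xi> w"
    by (rule mom_deriv_cong_words[OF w]) (simp_all add: cum_moments)
  finally show "poly (pderiv (moment_curve i s n \<xi> w)) t = (\<Sum>u\<in>words s n.
      jacobian (add_conv i s n (\<lambda>v. poly (moment_curve i s n \<xi> v) t)) (\<lambda>_. 0) w u * \<xi> u)"
    using w by (simp add: poly_moment_curve sum_jacobian_conv)
qed

lemma exp_curve_unique:
  fixes \<xi> :: "nat list \<Rightarrow> 'k::field_char_0"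
  assumes \<gamma>: "exp_curve (words s n) (add_conv i s n) \<xi> \<gamma>"
  shows "\<gamma> = moment_curve i s n \<xi>"
proof -
  have co: "\<gamma> \<in> coords (words s n)" and init: "\<And>w. w \<in> words s n \<Longrightarrow> poly (\<gamma> w) 0 = 0"
    and ode: "\<And>t w. w \<in> words s n \<Longrightarrow> poly (pderiv (\<gamma> w)) t
      = (\<Sum>u\<in>words s n. jacobian (add_conv i s n (\<lambda>v. poly (\<gamma> v) t)) (\<lambda>_. 0) w u * \<xi> u)"
    using \<gamma> by (auto simp: exp_curve_def)
  have \<gamma>0: "poly (\<gamma> w) 0 = 0" for w using co init by (cases "w \<in> words s n") (auto simp: coords_def)
  \<comment> \<open>Differentiating \<open>\<gamma> = mom i (cum i \<gamma>)\<close> and comparing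
    with the curve equation gives two directions, the velocity of the cumulants and
    \<open>\<xi>\<close>, with the same \<open>mom_deriv\<close>.\<close>
  have vel: "poly (pderiv (cum i \<gamma> w)) t = \<xi> w" if "w \<in> words s n" for w t
  proof (rule mom_deriv_inject[OF _ that])
    fix v assume v: "v \<in> words s n"
    have "(\<lambda>v. poly (\<gamma> v) t) \<in> coords (words s n)" using co by (simp add: coords_def)
    then have "mom_deriv i (\<lambda>v. poly (cum i \<gamma> v) t) \<xi> v = poly (pderiv (\<gamma> v)) t"
      using ode[OF v, of t] v by (simp add: sum_jacobian_conv poly_cum)
    also have "\<dots> = poly (pderiv (mom i (cum i \<gamma>) v)) t"
      by (simp add: mom_cum words_nonempty[OF v])
    finally show "mom_deriv i (\<lambda>v. poly (cum i \<gamma> v) t) (\<lambda>v. poly (pderiv (cum i \<gamma> v)) t) v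
        = mom_deriv i (\<lambda>v. poly (cum i \<gamma> v) t) \<xi> v"
      by (simp add: poly_pderiv_mom)
  qed
  have cum: "cum i \<gamma> w = [:0, \<xi> w:]" if w: "w \<in> words s n" for w
  proof -
    have "poly (pderiv (cum i \<gamma> w - [:0, \<xi> w:])) t = 0" for t
      using vel[OF w] by (simp add: pderiv_diff pderiv_pCons)
    \<comment> \<open>A polynomial with only zero values is 0 because the field is infinite; in
      characteristic 0 a vanishing derivative then leaves a constant, fixed by the value at
      0.\<close>
    then have "pderiv (cum i \<gamma> w - [:0, \<xi> w:]) = 0"
      using poly_all_0_iff_0 by blast
    then obtain c where c: "cum i \<gamma> w - [:0, \<xi> w:] = [:c:]"
      by (metis pderiv_eq_0_iff degree_eq_zeroE)
    have "poly (cum i \<gamma> w - [:0, \<xi> w:]) 0 = 0"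
      by (simp add: poly_cum \<gamma>0 cum_zero words_nonempty[OF w])
    then show ?thesis using c by simp
  qed
  show ?thesis
  proof
    fix w
    show "\<gamma> w = moment_curve i s n \<xi> w"
    proof (cases "w \<in> words s n")
      case True
      have "\<gamma> w = mom i (cum i \<gamma>) w" by (simp add: mom_cum words_nonempty[OF True])
      also have "\<dots> = mom i (\<lambda>v. [:0, \<xi> v:]) w" by (rule mom_cong_words[OF True]) (rule cum)
      finally show ?thesis using True by (simp add: moment_curve_def moments_def)
    qed (use co in \<open>simp add: moment_curve_def moments_def coords_def\<close>)
  qed
qed

lemma EXP_conv: "EXP (words s n) (add_conv i s n) = moments i s n"
proof -
  have "(THE \<gamma>. exp_curve (words s n) (add_conv i s n) \<xi> \<gamma>) = moment_curve i s n \<xi>"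
    for \<xi> :: "nat list \<Rightarrow> 'a"
    by (rule the_equality) (rule exp_curve_moment_curve exp_curve_unique, assumption?)+
  then show ?thesis by (simp add: EXP_def poly_moment_curve fun_eq_iff)
qed

text \<open>Stated on \<open>coords\<close>, the image of the moment map, since
  \<open>inv_into\<close> is unspecified elsewhere.\<close>

lemma LOG_conv:
  fixes f :: "nat list \<Rightarrow> 'k::field_char_0"
  assumes "f \<in> coords (words s n)"
  shows "LOG (words s n) (add_conv i s n) f = cumulants i s n f"
proof -
  have "inj_on (moments i s n) (coords (words s n) :: (nat list \<Rightarrow> 'k) set)"
    by (rule inj_on_inverseI[where g = "cumulants i s n"]) (rule cumulants_moments)
  then show ?thesis
    using moments_cumulants[OF assms, of i] inv_into_f_f[of "moments i s n" _ "cumulants i s n f"]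
    by (simp add: LOG_def EXP_conv)
qed

theorem theorem5p3:
  fixes s n :: nat
    and W :: "nat list set"
    and A :: "(nat list \<Rightarrow> 'k::field_char_0) monoid"
    and G :: "independence \<Rightarrow> (nat list \<Rightarrow> 'k) monoid"
    and opr :: "independence \<Rightarrow> (nat list \<Rightarrow> 'k) \<Rightarrow> (nat list \<Rightarrow> 'k) \<Rightarrow> nat list \<Rightarrow> 'k"
  defines "W \<equiv> words s n"
    and "A \<equiv> additive_group s n"
    and "G \<equiv> \<lambda>i. conv_group i s n"
    and "opr \<equiv> \<lambda>i. add_conv i s n"
  assumes "1 \<le> s" and "1 \<le> n"
  shows
    "(\<forall>i. comm_group (G i)
        \<and> homogeneous_group length (G i)
        \<and> polynomial_law W (opr i)
        \<and> G i \<cong> A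
        \<and> (\<forall>\<xi>\<in>coords W. \<exists>!\<gamma>. exp_curve W (opr i) \<xi> \<gamma>)
        \<and> LOG W (opr i) \<in> iso (G i) A
        \<and> EXP W (opr i) \<in> iso A (G i)) \<and>
     (\<forall>i j. EXP W (opr j) \<circ> LOG W (opr i) \<in> iso (G i) (G j)
        \<and> homogeneous_polynomial_map W length (EXP W (opr j) \<circ> LOG W (opr i)))"
proof -
  interpret A: comm_group A unfolding A_def by (rule comm_group_additive)
  have EXP: "EXP W (opr i) \<in> iso A (G i)" for i
    using moments_iso by (simp add: W_def opr_def A_def G_def EXP_conv)
  \<comment> \<open>\<open>A.iso_set_sym\<close> produces the inverse as \<open>inv_into\<close> of
    the carrier of \<open>A\<close>, which is literally \<open>LOG\<close>.\<close>
  have LOG: "LOG W (opr i) \<in> iso (G i) A" for i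
    using A.iso_set_sym[OF EXP[of i]]
    by (simp add: LOG_def A_def W_def additive_group_def law_monoid_def)
  have "\<exists>!\<gamma>. exp_curve W (opr i) \<xi> \<gamma>" for i \<xi>
    unfolding W_def opr_def using exp_curve_moment_curve exp_curve_unique by blast
  \<comment> \<open>The predicate inspects the map on \<open>coords\<close> alone, where
    \<open>LOG\<close> is known to be the cumulant map.\<close>
  moreover have "homogeneous_polynomial_map W length (EXP W (opr j) \<circ> LOG W (opr i))" for i j
    using homogeneous_polynomial_map_moments_cumulants[where ?'a = 'k, of s n j i]
    by (simp add: homogeneous_polynomial_map_def W_def opr_def EXP_conv LOG_conv)
  moreover have "comm_group (G i)" "homogeneous_group length (G i)" "polynomial_law W (opr i)" for i
    unfolding G_def W_def opr_def
    by (rule comm_group_conv homogeneous_conv polynomial_law_conv)+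
  ultimately show ?thesis
    using EXP LOG is_isoI[OF LOG] iso_set_trans[OF LOG EXP] by blast
qed

end
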